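(* Let $1/2\le\beta<1$ and $0<\theta<1$ with $\theta>2\beta-1$. Put $R_k=\beta^k$ and $$b_0=1,\qquad b_{k+1}=\max\{\,b_k-(1-\beta)R_k,\ \theta b_k+(1-\beta)R_k\,\},\qquad J=\min\Bigl\{k:\frac{b_k}{R_k}\ge\frac{2(1-\beta)}{1-\theta}\Bigr\}$$ ($J$ is finite). Then, with $n=J+1$, there exist a convex $C^\infty$ function $F$ on $\mathbb{R}^n$ with globally Lipschitz gradient and unique minimiser $0$, and a starting centre $c_0\in[-1,1]^n$, such that $F\in\mathcal{M}_{\mathbf 1}(\theta,0,\mathbb{R}^n)$ and, for some deterministic tie rule, the sequence generated by Cube-Sign$(\beta,\mathbf 1)$ applied to $F$ from $c_0$ with $r_0=1$ satisfies $$\|c_k\|_\infty=b_k\qquad\text{for all }k\ge0 .$$ When instead $0\le\theta\le2\beta-1$ (with $1/2\le\beta<1$), a one-dimensional quadratic with minimiser $0$ and a starting centre in $[-1,1]$ attain $|c_k|=b_k=R_k$ for all $k\ge0$.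
   Context: $\mathbf 1=(1,\dots,1)$. Algorithm Cube-Sign$(\beta,\mathbf 1)$ with $r_0=1$: at step $k$ take $s_k\in\{-1,+1\}^n$ with $s_{k,i}=\operatorname{sign}\partial_if(c_k)$ whenever $\partial_if(c_k)\ne0$; if $\partial_if(c_k)=0$, $s_{k,i}\in\{-1,+1\}$ is chosen by a tie rule (a rule depending only on query points, sign answers and previous choices). Then $c_{k+1}=c_k-(1-\beta)\beta^k s_k$. Class $\mathcal{M}_{\mathbf 1}(\theta,0,\mathbb{R}^n)$: differentiable functions $f$ on $\mathbb{R}^n$ such that for every $x$ and every $i$, $|x_i|>\theta\|x\|_\infty$ implies $\partial_if(x)\,x_i>0$. *)

theory Defs
  imports "HOL-Analysis.Analysis"
begin

definition partial_deriv :: "(real^'n \<Rightarrow> real) \<Rightarrow> 'n \<Rightarrow> real^'n \<Rightarrow> real" where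
  "partial_deriv f i x = frechet_derivative f (at x) (axis i 1)"

definition grad :: "(real^'n \<Rightarrow> real) \<Rightarrow> real^'n \<Rightarrow> real^'n" where
  "grad f x = (\<chi> i. partial_deriv f i x)"

text \<open>\<open>C\<^sup>k\<close> on the whole space: all iterated directional derivatives up to order \<open>k\<close> exist
  (as values of Frechet derivatives) and are continuous.\<close>

primrec Ck :: "nat \<Rightarrow> ('a::euclidean_space \<Rightarrow> 'b::real_normed_vector) \<Rightarrow> bool" where
  "Ck 0 f \<longleftrightarrow> continuous_on UNIV f"
| "Ck (Suc k) f \<longleftrightarrow> (\<forall>x. f differentiable (at x)) \<and>
     (\<forall>v. Ck k (\<lambda>x. frechet_derivative f (at x) v))"

definition smooth :: "('a::euclidean_space \<Rightarrow> 'b::real_normed_vector) \<Rightarrow> bool" where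
  "smooth f \<longleftrightarrow> (\<forall>k. Ck k f)"

text \<open>The class \<open>M\<^sub>1(\<theta>, 0, R\<^sup>n)\<close>; on \<open>real^'n\<close> the library's \<open>infnorm\<close> is the maximum norm.\<close>

definition M_class :: "real \<Rightarrow> (real^'n \<Rightarrow> real) set" where
  "M_class \<theta> = {f. (\<forall>x. f differentiable (at x)) \<and>
     (\<forall>x i. \<bar>x $ i\<bar> > \<theta> * infnorm x \<longrightarrow> partial_deriv f i x * x $ i > 0)}"

definition sign_answer :: "(real^'n \<Rightarrow> real) \<Rightarrow> real^'n \<Rightarrow> real^'n" where
  "sign_answer f c = (\<chi> i. sgn (partial_deriv f i c))"

text \<open>A tie rule sees the list of all earlier rounds, oldest first, each recorded as
  (query point, sign answer, chosen sign vector), then the current query point and the current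
  sign answer. It does not see the function itself. Only those of its entries where the current
  sign answer vanishes are used.\<close>

type_synonym 'n history = "((real^'n) \<times> (real^'n) \<times> (real^'n)) list"
type_synonym 'n tie_rule = "'n history \<Rightarrow> real^'n \<Rightarrow> real^'n \<Rightarrow> real^'n"

definition tie_rule :: "'n::finite tie_rule \<Rightarrow> bool" where
  "tie_rule \<tau> \<longleftrightarrow> (\<forall>h c \<sigma> i. \<tau> h c \<sigma> $ i \<in> {-1, 1})"

definition chosen_signs ::
  "(real^'n::finite \<Rightarrow> real) \<Rightarrow> 'n tie_rule \<Rightarrow> 'n history \<Rightarrow> real^'n \<Rightarrow> real^'n" where
  "chosen_signs f \<tau> h c =
     (\<chi> i. if partial_deriv f i c \<noteq> 0 then sgn (partial_deriv f i c)
           else \<tau> h c (sign_answer f c) $ i)"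

text \<open>State of Cube-Sign\<open>(\<beta>, 1)\<close> with \<open>r\<^sub>0 = 1\<close> before step \<open>k\<close>: the history of
  steps \<open>0, \<dots>, k - 1\<close> and the centre \<open>c\<^sub>k\<close>.\<close>

primrec cube_sign_state ::
  "real \<Rightarrow> (real^'n::finite \<Rightarrow> real) \<Rightarrow> 'n tie_rule \<Rightarrow> real^'n \<Rightarrow> nat \<Rightarrow> 'n history \<times> (real^'n)" where
  "cube_sign_state \<beta> f \<tau> c0 0 = ([], c0)"
| "cube_sign_state \<beta> f \<tau> c0 (Suc k) =
     (let (h, c) = cube_sign_state \<beta> f \<tau> c0 k; s = chosen_signs f \<tau> h c
      in (h @ [(c, sign_answer f c, s)], c - ((1 - \<beta>) * \<beta> ^ k) *\<^sub>R s))"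

definition cube_sign ::
  "real \<Rightarrow> (real^'n::finite \<Rightarrow> real) \<Rightarrow> 'n tie_rule \<Rightarrow> real^'n \<Rightarrow> nat \<Rightarrow> real^'n" where
  "cube_sign \<beta> f \<tau> c0 k = snd (cube_sign_state \<beta> f \<tau> c0 k)"

primrec bound :: "real \<Rightarrow> real \<Rightarrow> nat \<Rightarrow> real" where
  "bound \<beta> \<theta> 0 = 1"
| "bound \<beta> \<theta> (Suc k) =
     max (bound \<beta> \<theta> k - (1 - \<beta>) * \<beta> ^ k) (\<theta> * bound \<beta> \<theta> k + (1 - \<beta>) * \<beta> ^ k)"

definition reaches_threshold :: "real \<Rightarrow> real \<Rightarrow> nat \<Rightarrow> bool" where
  "reaches_threshold \<beta> \<theta> k \<longleftrightarrow> bound \<beta> \<theta> k / \<beta> ^ k \<ge> 2 * (1 - \<beta>) / (1 - \<theta>)"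

definition J_index :: "real \<Rightarrow> real \<Rightarrow> nat" where
  "J_index \<beta> \<theta> = (LEAST k. reaches_threshold \<beta> \<theta> k)"

end

theory Submission
  imports Defs
begin

text \<open>Write \<open>b\<^sub>k\<close> for the recursion \<open>bound\<close> and \<open>w\<^sub>k = (1 - \<beta>) \<beta>\<^sup>k\<close> for the step length.
  No function of the class can exceed \<open>b\<^sub>k\<close>: a coordinate above \<open>\<theta> \<parallel>c\<^sub>k\<parallel>\<close> is pushed inwards, any other
  one ends at most at \<open>\<theta> b\<^sub>k + w\<^sub>k\<close> (\<open>infnorm_cube_sign_le\<close>). To attain the bound, a fresh coordinate is
  spent on each step before the threshold time \<open>J\<close>. Coordinate \<open>i\<close> starts at \<open>b\<^sub>i - 1 + \<beta>\<^sup>i\<close> and moves up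
  in each of the first \<open>i\<close> steps, so that it sits at \<open>b\<^sub>i\<close> at time \<open>i\<close>; its position at time \<open>j\<close> is
  \<open>b\<^sub>i - \<beta>\<^sup>j + \<beta>\<^sup>i\<close>, and this is at most \<open>\<theta> b\<^sub>j\<close> for \<open>j < i\<close>. From time \<open>J\<close> on the recursion only subtracts
  \<open>w\<^sub>k\<close>, which is what happens to the coordinate \<open>J\<close>, being the largest one.

  The upward moves are free while the coordinate is negative. When it is positive they need a tie, so
  the function must have an exactly vanishing partial derivative there, although the same partial
  derivative is nonzero as soon as the coordinate exceeds \<open>\<theta>\<close> times the norm. With \<open>h(t) = sqrt (1 + t\<^sup>2)\<close> (\<open>hyp\<close>),
  a nonsmooth function of this kind is the sum over \<open>i\<close> of \<open>max (h (x\<^sub>i)) (h (\<theta> x\<^sub>0)) \<dots> (h (\<theta> x\<^sub>i\<^sub>-\<^sub>1))\<close>: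
  the \<open>i\<close>-th summand sees \<open>x\<^sub>i\<close> only above all the values \<open>\<theta> \<bar>x\<^sub>j\<bar>\<close>, \<open>j < i\<close>, and at time \<open>j\<close> the value
  \<open>\<theta> \<bar>x\<^sub>j\<bar> = \<theta> b\<^sub>j\<close> is among them. The later summands contain \<open>\<theta> \<bar>x\<^sub>i\<bar>\<close>, which \<open>\<theta> \<bar>x\<^sub>j\<bar>\<close>
  dominates at that time.

  The maximum of \<open>a\<close> and \<open>b\<close> is smoothed to \<open>b + \<psi> (a - b)\<close>, where \<open>\<psi>\<close> is a convex ramp that vanishes on
  the negative axis and has slope 1 beyond a small \<open>\<delta>\<close>. This expression is convex and monotone in
  both arguments, lies between \<open>b\<close> and \<open>max a b\<close>, and loses at most \<open>\<delta>\<close> against \<open>a\<close>. So the smoothed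
  inner maximum never exceeds \<open>h (\<theta> \<parallel>x\<parallel>)\<close>, which gives membership in the class (\<open>F_in_M_class\<close>). Taking
  the newest coordinate as the argument \<open>b\<close> makes the inner maximum for \<open>i = j + 1\<close> at least \<open>h (\<theta> x\<^sub>j)\<close>
  without any loss, which is the one place where a tie has to occur exactly on the boundary
  \<open>\<bar>x\<^sub>i\<bar> = \<theta> \<parallel>x\<parallel>\<close>. All other ties that are needed have a positive margin, finitely many margins in
  total, so a small \<open>\<delta>\<close> does not destroy them (\<open>adversarial_instance\<close>). The choice of \<open>h\<close>, with bounded
  first and second derivatives, makes the gradient globally Lipschitz.\<close>

section \<open>Smoothness by closure under differentiation\<close>

text \<open>Smoothness of the function is proved without computing iterated derivatives: the class below
  consists of differentiable functions and contains all directional derivatives of its members. In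
  the composition rule, \<open>d\<close> lists a function of one variable on \<open>U\<close> together with all its derivatives;
  admitting every \<open>d m\<close> is what makes the class closed.\<close>

inductive smooth_expr :: "('a::euclidean_space \<Rightarrow> real) \<Rightarrow> bool" where
  const: "smooth_expr (\<lambda>x. c)"
| linear: "bounded_linear f \<Longrightarrow> smooth_expr f"
| add: "smooth_expr f \<Longrightarrow> smooth_expr g \<Longrightarrow> smooth_expr (\<lambda>x. f x + g x)"
| mult: "smooth_expr f \<Longrightarrow> smooth_expr g \<Longrightarrow> smooth_expr (\<lambda>x. f x * g x)"
| comp: "smooth_expr f \<Longrightarrow> (\<And>x. f x \<in> U) \<Longrightarrow>
    (\<And>k y. y \<in> U \<Longrightarrow> (d k has_real_derivative d (Suc k) y) (at y)) \<Longrightarrow>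
    smooth_expr (\<lambda>x. d m (f x))"

lemma smooth_expr_has_derivative:
  assumes "smooth_expr f"
  shows "\<exists>f'. (\<forall>x. (f has_derivative f' x) (at x)) \<and> (\<forall>v. smooth_expr (\<lambda>x. f' x v))"
  using assms
proof induction
  case (const c)
  show ?case
    by (rule exI[of _ "\<lambda>x v. 0"]) (auto intro: smooth_expr.const)
next
  case (linear f)
  then show ?case
    by (intro exI[of _ "\<lambda>x. f"]) (auto intro: smooth_expr.const bounded_linear_imp_has_derivative)
next
  case (add f g)
  then obtain f' g' where
    "\<And>x. (f has_derivative f' x) (at x)" "\<And>v. smooth_expr (\<lambda>x. f' x v)"
    "\<And>x. (g has_derivative g' x) (at x)" "\<And>v. smooth_expr (\<lambda>x. g' x v)" by blast
  then show ?case
    by (intro exI[of _ "\<lambda>x v. f' x v + g' x v"])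
      (auto intro!: smooth_expr.add derivative_eq_intros)
next
  case (mult f g)
  then obtain f' g' where
    "\<And>x. (f has_derivative f' x) (at x)" "\<And>v. smooth_expr (\<lambda>x. f' x v)"
    "\<And>x. (g has_derivative g' x) (at x)" "\<And>v. smooth_expr (\<lambda>x. g' x v)" by blast
  then show ?case using mult.hyps
    by (intro exI[of _ "\<lambda>x v. f x * g' x v + f' x v * g x"])
      (auto intro!: smooth_expr.add smooth_expr.mult has_derivative_mult)
next
  case (comp f U d m)
  then obtain f' where f':
    "\<And>x. (f has_derivative f' x) (at x)" "\<And>v. smooth_expr (\<lambda>x. f' x v)" by blast
  have "((\<lambda>x. d m (f x)) has_derivative (\<lambda>v. f' x v * d (Suc m) (f x))) (at x)" for x
  proof -
    have "(d m has_derivative (*) (d (Suc m) (f x))) (at (f x))"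
      using comp.hyps(3)[OF comp.hyps(2)] by (simp add: has_field_derivative_def)
    from has_derivative_compose[OF f'(1)[of x] this] show ?thesis
      by (simp add: mult.commute)
  qed
  moreover have "smooth_expr (\<lambda>x. f' x v * d (Suc m) (f x))" for v
    by (rule smooth_expr.mult[OF f'(2)[of v]
          smooth_expr.comp[where d = d and m = "Suc m", OF comp.hyps]])
  ultimately show ?case
    by (intro exI[of _ "\<lambda>x v. f' x v * d (Suc m) (f x)"]) simp
qed

lemma smooth_expr_imp_smooth:
  assumes "smooth_expr f"
  shows "smooth f"
proof -
  have "smooth_expr f \<Longrightarrow> Ck k f" for k and f :: "'a \<Rightarrow> real"
  proof (induction k arbitrary: f)
    case 0
    then show ?case
      using smooth_expr_has_derivative[OF 0]
      by (auto intro!: continuous_at_imp_continuous_on dest: has_derivative_continuous)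
  next
    case (Suc k)
    obtain f' where f': "\<And>x. (f has_derivative f' x) (at x)" "\<And>v. smooth_expr (\<lambda>x. f' x v)"
      using smooth_expr_has_derivative[OF Suc.prems] by blast
    then have "frechet_derivative f (at x) = f' x" for x
      by (metis frechet_derivative_at)
    with f' Suc.IH show ?case
      by (auto simp: differentiable_def)
  qed
  then show ?thesis using assms by (simp add: smooth_def)
qed

lemma smooth_expr_sum:
  "(\<And>i. i \<in> I \<Longrightarrow> smooth_expr (f i)) \<Longrightarrow> smooth_expr (\<lambda>x. \<Sum>i\<in>I. f i x)"
  by (induction I rule: infinite_finite_induct) (auto intro: smooth_expr.intros)

lemma smooth_expr_diff:
  assumes "smooth_expr f" "smooth_expr g"
  shows "smooth_expr (\<lambda>x. f x - g x)"
  using smooth_expr.add[OF assms(1) smooth_expr.mult[OF smooth_expr.const[of "-1"] assms(2)]] by simp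

text \<open>Turns membership in the class into the list of derivatives that the composition rule asks for.\<close>

lemma smooth_expr_derivative_tower:
  fixes f :: "real \<Rightarrow> real"
  assumes "smooth_expr f"
  shows "\<exists>d. d 0 = f \<and> (\<forall>k t. (d k has_real_derivative d (Suc k) t) (at t))"
proof -
  have step: "\<exists>g'. smooth_expr g' \<and> (\<forall>t. (g has_real_derivative g' t) (at t))"
    if g: "smooth_expr g" for g :: "real \<Rightarrow> real"
  proof -
    obtain g' where g': "\<And>x. (g has_derivative g' x) (at x)" "\<And>v. smooth_expr (\<lambda>x. g' x v)"
      using smooth_expr_has_derivative[OF g] by blast
    have "(g has_real_derivative g' t 1) (at t)" for t
    proof -
      have "g' t v = g' t 1 * v" for v
        using linear_scale[OF has_derivative_linear[OF g'(1)], of t v 1] by simp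
      then have "g' t = (*) (g' t 1)" by (rule ext)
      then show ?thesis using g'(1)[of t] by (simp add: has_field_derivative_def)
    qed
    with g'(2) show ?thesis by blast
  qed
  have "\<exists>d. \<forall>k. (smooth_expr (d k) \<and> (k = 0 \<longrightarrow> d k = f)) \<and>
      (\<forall>t. (d k has_real_derivative d (Suc k) t) (at t))"
  proof (rule dependent_nat_choice)
    show "\<exists>g. smooth_expr g \<and> (0 = (0::nat) \<longrightarrow> g = f)"
      using assms by blast
    show "\<exists>g'. (smooth_expr g' \<and> (Suc k = 0 \<longrightarrow> g' = f)) \<and>
        (\<forall>t. (g has_real_derivative g' t) (at t))"
      if "smooth_expr g \<and> (k = 0 \<longrightarrow> g = f)" for g and k :: nat
      using step that by auto
  qed
  then show ?thesis by metis
qed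

text \<open>The functions \<open>p (1/t) exp (-1/t)\<close>, extended by 0, are closed under differentiation when all
  polynomials \<open>p\<close> are admitted, so the derivatives of \<open>exp (-1/t)\<close> at 0 need no separate treatment.\<close>

definition flat_exp :: "real poly \<Rightarrow> real \<Rightarrow> real" where
  "flat_exp p t = (if t \<le> 0 then 0 else poly p (1 / t) * exp (- (1 / t)))"

lemma poly_times_exp_minus_tendsto_0:
  "((\<lambda>u::real. poly p u * exp (- u)) \<longlongrightarrow> 0) at_top"
proof -
  have "((\<lambda>u::real. \<Sum>i\<le>degree p. coeff p i * (u ^ i / exp u)) \<longlongrightarrow> (\<Sum>i\<le>degree p. coeff p i * 0)) at_top"
    by (intro tendsto_intros tendsto_power_div_exp_0)
  then show ?thesis
    by (simp add: poly_altdef sum_distrib_right sum_divide_distrib exp_minus divide_inverse mult.assoc)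
qed

text \<open>With \<open>u = 1/t\<close> the derivative of \<open>p(u) exp(-u)\<close> is \<open>u\<^sup>2 (p(u) - p'(u)) exp(-u)\<close>. At 0 the difference
  quotient is \<open>u p(u) exp(-u)\<close> with \<open>u\<close> tending to infinity.\<close>

lemma flat_exp_has_derivative:
  "(flat_exp p has_real_derivative flat_exp ([:0, 0, 1:] * (p - pderiv p)) t) (at t)"
proof -
  consider "t < 0" | "t > 0" | "t = 0" by linarith
  then show ?thesis
  proof cases
    case 1
    have "eventually (\<lambda>s. flat_exp p s = 0) (nhds t)"
      using eventually_nhds_in_open[of "{..<0}" t] 1 by (auto simp: flat_exp_def elim!: eventually_mono)
    with 1 show ?thesis
      by (subst DERIV_cong_ev[OF refl _ refl]) (auto simp: flat_exp_def)
  next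
    case 2
    have "eventually (\<lambda>s. flat_exp p s = poly p (1 / s) * exp (- (1 / s))) (nhds t)"
      using eventually_nhds_in_open[of "{0<..}" t] 2 by (auto simp: flat_exp_def elim!: eventually_mono)
    moreover have "((\<lambda>s. poly p (1 / s) * exp (- (1 / s))) has_real_derivative
        flat_exp ([:0, 0, 1:] * (p - pderiv p)) t) (at t)"
      using 2 by (auto simp: flat_exp_def field_simps power2_eq_square intro!: derivative_eq_intros DERIV_chain2[OF poly_DERIV])
    ultimately show ?thesis
      by (subst DERIV_cong_ev[OF refl _ refl])
  next
    case 3
    have "((\<lambda>s. flat_exp p s / s) \<longlongrightarrow> 0) (at 0)"
      unfolding filterlim_split_at_real
    proof (rule filterlim_split_at)
      show "((\<lambda>s. flat_exp p s / s) \<longlongrightarrow> 0) (at_left 0)"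
        by (rule tendsto_eventually) (auto simp: flat_exp_def eventually_at_filter)
      have "((\<lambda>s. poly ([:0, 1:] * p) (1 / s) * exp (- (1 / s))) \<longlongrightarrow> 0) (at_right 0)"
        using filterlim_compose[OF poly_times_exp_minus_tendsto_0[of "[:0, 1:] * p"] filterlim_inverse_at_top_right]
        by (simp add: divide_inverse)
      then show "((\<lambda>s. flat_exp p s / s) \<longlongrightarrow> 0) (at_right 0)"
        by (rule filterlim_mono_eventually) (auto simp: flat_exp_def eventually_at_filter)
    qed
    with 3 show ?thesis
      by (simp add: has_field_derivative_iff flat_exp_def)
  qed
qed

lemma smooth_expr_flat_exp:
  assumes "smooth_expr f"
  shows "smooth_expr (\<lambda>x. flat_exp 1 (f x))"
proof -
  define P :: "nat \<Rightarrow> real poly" where "P k = ((\<lambda>p. [:0, 0, 1:] * (p - pderiv p)) ^^ k) 1" for k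
  have "(flat_exp (P k) has_real_derivative flat_exp (P (Suc k)) t) (at t)" for k t
    using flat_exp_has_derivative[of "P k" t] by (simp only: P_def funpow.simps o_apply)
  then have "smooth_expr (\<lambda>x. flat_exp (P 0) (f x))"
    by (intro smooth_expr.comp[where U = UNIV and d = "\<lambda>k. flat_exp (P k)", OF assms]) auto
  then show ?thesis by (simp add: P_def)
qed

lemma continuous_antiderivative_vanishing:
  fixes f :: "real \<Rightarrow> real"
  assumes cont: "continuous_on UNIV f" and zero: "\<And>t. t \<le> 0 \<Longrightarrow> f t = 0"
  shows "\<exists>g. (\<forall>t. (g has_real_derivative f t) (at t)) \<and> (\<forall>t\<le>0. g t = 0)"
proof (intro exI conjI allI impI)
  let ?g = "\<lambda>t. integral {0..t} f"
  show "?g t = 0" if "t \<le> 0" for t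
    using that by (cases "t = 0") auto
  show "(?g has_real_derivative f t) (at t)" for t
  proof -
    define a where "a = min 0 t - 1"
    have "((\<lambda>u. integral {a..u} f) has_real_derivative f t) (at t within {a..t + 1})"
      using cont by (intro integral_has_real_derivative) (auto intro: continuous_on_subset simp: a_def)
    then have "((\<lambda>u. integral {a..u} f) has_real_derivative f t) (at t)"
      by (subst (asm) at_within_interior) (auto simp: a_def)
    moreover have "eventually (\<lambda>u. ?g u = integral {a..u} f) (nhds t)"
    proof -
      have "?g u = integral {a..u} f" if u: "u > a" for u
      proof (cases "u \<le> 0")
        case True
        have "integral {a..u} f = integral {a..u} (\<lambda>_. 0)"
          using True zero by (intro integral_cong) auto
        then show ?thesis using True by (cases "u = 0") auto
      next
        case False
        have "integral {a..0} f + integral {0..u} f = integral {a..u} f"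
          using False cont by (intro Henstock_Kurzweil_Integration.integral_combine)
            (auto simp: a_def intro!: integrable_continuous_real continuous_on_subset[OF cont])
        moreover have "integral {a..0} f = integral {a..0} (\<lambda>_. 0)"
          using zero by (intro integral_cong) auto
        ultimately show ?thesis by simp
      qed
      then show ?thesis
        using eventually_nhds_in_open[of "{a<..}" t] eventually_mono[of "\<lambda>u. u \<in> {a<..}"]
        by (simp add: a_def)
    qed
    ultimately show ?thesis
      by (subst DERIV_cong_ev[OF refl _ refl])
  qed
qed

section \<open>Smooth convex ramps\<close>

locale ramp =
  fixes \<delta> :: real and \<psi> \<psi>' :: "real \<Rightarrow> real"
  assumes \<delta>_pos: "\<delta> > 0"
    and DERIV_\<psi>: "\<And>t. (\<psi> has_real_derivative \<psi>' t) (at t)"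
    and tower_\<psi>: "\<exists>d. d 0 = \<psi> \<and> (\<forall>k t. (d k has_real_derivative d (Suc k) t) (at t))"
    and \<psi>_eq_0: "\<And>t. t \<le> 0 \<Longrightarrow> \<psi> t = 0"
    and \<psi>'_eq_0: "\<And>t. t \<le> 0 \<Longrightarrow> \<psi>' t = 0"
    and \<psi>'_pos: "\<And>t. t > 0 \<Longrightarrow> \<psi>' t > 0"
    and \<psi>'_eq_1: "\<And>t. t \<ge> \<delta> \<Longrightarrow> \<psi>' t = 1"
    and mono_\<psi>': "mono \<psi>'"
    and lipschitz_\<psi>': "\<exists>L. L-lipschitz_on UNIV \<psi>'"

text \<open>The second derivative of the ramp is a multiple of the bump \<open>exp (-1/t) exp (-1/(\<delta> - t))\<close> on
  \<open>(0, \<delta>)\<close>; integrating twice gives the ramp. Normalising by the total mass \<open>q \<delta>\<close> of the bump makes the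
  slope equal to 1 from \<open>\<delta>\<close> on.\<close>

lemma ramp_exists:
  assumes "\<delta> > 0"
  shows "\<exists>\<psi> \<psi>'. ramp \<delta> \<psi> \<psi>'"
proof -
  define bump where "bump t = flat_exp 1 t * flat_exp 1 (\<delta> - t)" for t
  have smooth_bump: "smooth_expr bump"
    unfolding bump_def
    by (intro smooth_expr.mult smooth_expr_flat_exp smooth_expr_diff smooth_expr.const
        smooth_expr.linear bounded_linear_ident)
  have bump_nonneg: "bump t \<ge> 0" for t
    by (simp add: bump_def flat_exp_def)
  have bump_le_1: "bump t \<le> 1" for t
    using zero_le_divide_1_iff[of t] zero_le_divide_1_iff[of "\<delta> - t"]
    by (auto simp: bump_def flat_exp_def intro!: mult_le_one)
  have bump_pos: "bump t > 0" if "0 < t" "t < \<delta>" for t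
    using that by (simp add: bump_def flat_exp_def)
  have bump_0: "bump t = 0" if "t \<le> 0 \<or> \<delta> \<le> t" for t
    using that by (auto simp: bump_def flat_exp_def)
  obtain d where d: "d 0 = bump" "\<And>k t. (d k has_real_derivative d (Suc k) t) (at t)"
    using smooth_expr_derivative_tower[OF smooth_bump] by blast
  have "continuous_on UNIV bump"
    using d(2)[of 0] d(1) by (auto intro!: continuous_at_imp_continuous_on dest: DERIV_isCont)
  then obtain q where q: "\<And>t. (q has_real_derivative bump t) (at t)" "\<And>t. t \<le> 0 \<Longrightarrow> q t = 0"
    using continuous_antiderivative_vanishing[of bump] bump_0 by blast
  have q_mono: "q s \<le> q t" if "s \<le> t" for s t
    using DERIV_nonneg_imp_nondecreasing[OF that] q(1) bump_nonneg by blast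
  have q_pos: "q t > 0" if "t > 0" for t
  proof -
    have "q 0 < q (min t (\<delta> / 2))"
    proof (rule DERIV_pos_imp_increasing_open[where f = q])
      show "0 < min t (\<delta> / 2)" using that assms by simp
      show "\<exists>y. (q has_real_derivative y) (at s) \<and> 0 < y" if "0 < s" "s < min t (\<delta> / 2)" for s
        using q(1) bump_pos[of s] that by auto
      show "continuous_on {0..min t (\<delta> / 2)} q"
        using q(1) by (blast intro: continuous_at_imp_continuous_on DERIV_isCont)
    qed
    also have "\<dots> \<le> q t" by (intro q_mono) simp
    finally show ?thesis using q(2)[of 0] by simp
  qed
  have q_const: "q t = q \<delta>" if "\<delta> \<le> t" for t
  proof (rule antisym)
    have "- q \<delta> \<le> - q t"
      by (rule DERIV_nonneg_imp_nondecreasing[OF that, where f = "\<lambda>s. - q s"])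
        (use q(1) bump_0 in \<open>auto intro!: exI[of _ 0] derivative_eq_intros\<close>)
    then show "q t \<le> q \<delta>" by simp
  qed (rule q_mono[OF that])
  define \<psi>' where "\<psi>' t = q t / q \<delta>" for t
  have DERIV_\<psi>': "(\<psi>' has_real_derivative bump t / q \<delta>) (at t)" for t
    unfolding \<psi>'_def using q_pos[OF assms] by (auto intro!: derivative_eq_intros q(1))
  have "continuous_on UNIV \<psi>'"
    using DERIV_\<psi>' by (auto intro!: continuous_at_imp_continuous_on dest: DERIV_isCont)
  then obtain \<psi> where \<psi>: "\<And>t. (\<psi> has_real_derivative \<psi>' t) (at t)" "\<And>t. t \<le> 0 \<Longrightarrow> \<psi> t = 0"
    using continuous_antiderivative_vanishing[of \<psi>'] q(2) by (auto simp: \<psi>'_def)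
  have "ramp \<delta> \<psi> \<psi>'"
  proof
    let ?d = "\<lambda>k. case k of 0 \<Rightarrow> \<psi> | Suc 0 \<Rightarrow> \<psi>' | Suc (Suc k) \<Rightarrow> (\<lambda>t. d k t / q \<delta>)"
    have "(?d k has_real_derivative ?d (Suc k) t) (at t)" for k t
      using d \<psi>(1) DERIV_\<psi>' q_pos[OF assms]
      by (auto split: nat.splits intro!: derivative_eq_intros)
    then show "\<exists>d. d 0 = \<psi> \<and> (\<forall>k t. (d k has_real_derivative d (Suc k) t) (at t))"
      by (intro exI[of _ ?d]) simp
    show "\<exists>L. L-lipschitz_on UNIV \<psi>'"
    proof (intro exI lipschitz_onI)
      show "dist (\<psi>' s) (\<psi>' t) \<le> 1 / q \<delta> * dist s t" for s t
        using field_differentiable_bound[of UNIV \<psi>' "\<lambda>t. bump t / q \<delta>" "1 / q \<delta>" s t]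
          DERIV_\<psi>' bump_nonneg bump_le_1 q_pos[OF assms]
        by (simp add: dist_norm divide_right_mono)
      show "0 \<le> 1 / q \<delta>" using q_pos[OF assms] by simp
    qed
    show "mono \<psi>'"
      using q_mono q_pos[OF assms] by (auto simp: mono_def \<psi>'_def divide_right_mono)
    show "\<psi>' t = 1" if "\<delta> \<le> t" for t
      using q_const[OF that] q_pos[OF assms] by (simp add: \<psi>'_def)
  qed (use assms \<psi> q(2) q_pos in \<open>auto simp: \<psi>'_def\<close>)
  then show ?thesis by blast
qed

text \<open>Lipschitz continuity of the function and boundedness of its gradient are included because the
  smoothed maximum multiplies the difference of two gradients by the slope of the ramp at the
  difference of the two functions; a product of Lipschitz maps need not be Lipschitz unless the
  factors are bounded.\<close>

definition has_lipschitz_gradient :: "('a::euclidean_space \<Rightarrow> real) \<Rightarrow> ('a \<Rightarrow> 'a) \<Rightarrow> bool" where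
  "has_lipschitz_gradient f g \<longleftrightarrow>
     (\<forall>x. (f has_derivative (\<lambda>v. g x \<bullet> v)) (at x)) \<and> (\<exists>L. L-lipschitz_on UNIV f) \<and>
     (\<exists>M. \<forall>x. norm (g x) \<le> M) \<and> (\<exists>L. L-lipschitz_on UNIV g)"

lemma has_lipschitz_gradient_const: "has_lipschitz_gradient (\<lambda>x. c) (\<lambda>x. 0)"
proof -
  have "(\<bullet>) (0 :: 'a) = (\<lambda>v. 0)" by (simp add: fun_eq_iff)
  then show ?thesis
    unfolding has_lipschitz_gradient_def by (auto intro: lipschitz_on_constant)
qed

lemma has_lipschitz_gradient_sum:
  assumes "\<And>i. i \<in> I \<Longrightarrow> has_lipschitz_gradient (f i) (g i)"
  shows "has_lipschitz_gradient (\<lambda>x. \<Sum>i\<in>I. f i x) (\<lambda>x. \<Sum>i\<in>I. g i x)"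
  using assms
proof (induction I rule: infinite_finite_induct)
  case (insert i I)
  have fi: "has_lipschitz_gradient (f i) (g i)"
    and fI: "has_lipschitz_gradient (\<lambda>x. \<Sum>i\<in>I. f i x) (\<lambda>x. \<Sum>i\<in>I. g i x)"
    using insert by auto
  obtain L M L' N K N' where bounds: "L-lipschitz_on UNIV (f i)" "M-lipschitz_on UNIV (g i)"
    "L'-lipschitz_on UNIV (\<lambda>x. \<Sum>i\<in>I. f i x)" "N-lipschitz_on UNIV (\<lambda>x. \<Sum>i\<in>I. g i x)"
    "\<And>x. norm (g i x) \<le> K" "\<And>x. norm (\<Sum>i\<in>I. g i x) \<le> N'"
    using fi fI unfolding has_lipschitz_gradient_def by blast
  have "norm (g i x + (\<Sum>i\<in>I. g i x)) \<le> K + N'" for x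
    using norm_triangle_le[OF add_mono[OF bounds(5,6)]] .
  moreover have "((\<lambda>x. f i x + (\<Sum>i\<in>I. f i x)) has_derivative (\<lambda>v. (g i x + (\<Sum>i\<in>I. g i x)) \<bullet> v)) (at x)" for x
    using fi fI unfolding has_lipschitz_gradient_def
    by (auto intro!: derivative_eq_intros simp: inner_add_left)
  ultimately show ?case
    using insert(1,2) bounds(1-4) unfolding has_lipschitz_gradient_def
    by (auto intro: lipschitz_on_add)
qed (simp_all add: has_lipschitz_gradient_const)

lemma has_lipschitz_gradient_imp_grad:
  fixes f :: "real^'n \<Rightarrow> real"
  assumes "has_lipschitz_gradient f g"
  shows "grad f = g"
proof -
  have "frechet_derivative f (at x) = (\<lambda>v. g x \<bullet> v)" for x
    using assms frechet_derivative_at[of f "\<lambda>v. g x \<bullet> v" x]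
    by (simp add: has_lipschitz_gradient_def)
  then show ?thesis
    by (auto simp: grad_def partial_deriv_def inner_axis vec_eq_iff)
qed

context ramp
begin

lemma \<psi>'_nonneg: "0 \<le> \<psi>' t"
  using \<psi>'_eq_0 \<psi>'_pos by (cases "t \<le> 0") (auto simp: less_imp_le)

lemma \<psi>'_le_1: "\<psi>' t \<le> 1"
  using monoD[OF mono_\<psi>', of t "max t \<delta>"] \<psi>'_eq_1[of "max t \<delta>"] by simp

lemma \<psi>_mono: "s \<le> t \<Longrightarrow> \<psi> s \<le> \<psi> t"
  using DERIV_nonneg_imp_nondecreasing[of s t \<psi>] DERIV_\<psi> \<psi>'_nonneg by blast

lemma \<psi>_diff_le:
  assumes "s \<le> t" shows "\<psi> t - \<psi> s \<le> t - s"
proof -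
  have "s - \<psi> s \<le> t - \<psi> t"
    by (rule DERIV_nonneg_imp_nondecreasing[OF assms])
      (auto intro!: exI[of _ "1 - \<psi>' _"] derivative_eq_intros DERIV_\<psi> simp: \<psi>'_le_1)
  then show ?thesis by simp
qed

lemma \<psi>_nonneg: "0 \<le> \<psi> t"
  using \<psi>_mono[of 0 t] \<psi>_eq_0[of 0] \<psi>_eq_0[of t] by linarith

lemma \<psi>_le: "\<psi> t \<le> max 0 t"
  using \<psi>_diff_le[of 0 t] \<psi>_eq_0[of 0] \<psi>_eq_0[of t] by linarith

lemma \<psi>_ge: "t - \<delta> \<le> \<psi> t"
proof (cases "t \<le> \<delta>")
  case False
  then obtain \<xi> where "\<delta> < \<xi>" "\<psi> t - \<psi> \<delta> = (t - \<delta>) * \<psi>' \<xi>"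
    using MVT2[of \<delta> t \<psi> \<psi>'] DERIV_\<psi> by auto
  then show ?thesis using \<psi>'_eq_1[of \<xi>] \<psi>_nonneg[of \<delta>] by simp
qed (use \<psi>_nonneg[of t] in simp)

lemma \<psi>_pos:
  assumes "0 < t" shows "0 < \<psi> t"
  using DERIV_pos_imp_increasing_open[of 0 t \<psi>] assms DERIV_\<psi> \<psi>'_pos \<psi>_eq_0[of 0]
  by (force intro!: continuous_at_imp_continuous_on DERIV_isCont)

lemma \<psi>_convex: "convex_on UNIV \<psi>"
  by (rule convex_on_realI[where f' = \<psi>']) (use DERIV_\<psi> mono_\<psi>' in \<open>auto simp: mono_def\<close>)

lemma smooth_expr_\<psi>:
  assumes "smooth_expr f"
  shows "smooth_expr (\<lambda>x. \<psi> (f x))"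
proof -
  obtain d where d: "d 0 = \<psi>" "\<And>k t. (d k has_real_derivative d (Suc k) t) (at t)"
    using tower_\<psi> by blast
  have "smooth_expr (\<lambda>x. d 0 (f x))"
    by (rule smooth_expr.comp[where U = UNIV and d = d, OF assms]) (simp_all add: d(2))
  then show ?thesis by (simp add: d(1))
qed

text \<open>The two arguments play different roles: the second one is never underestimated.\<close>

definition smooth_max :: "real \<Rightarrow> real \<Rightarrow> real" where
  "smooth_max a b = b + \<psi> (a - b)"

lemma smooth_max_ge: "b \<le> smooth_max a b" "a - \<delta> \<le> smooth_max a b"
  using \<psi>_nonneg[of "a - b"] \<psi>_ge[of "a - b"] by (simp_all add: smooth_max_def)

lemma smooth_max_le: "smooth_max a b \<le> max a b"
  using \<psi>_le[of "a - b"] by (simp add: smooth_max_def)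

lemma smooth_max_mono:
  assumes "a \<le> a'" "b \<le> b'"
  shows "smooth_max a b \<le> smooth_max a' b'"
proof -
  have "smooth_max a b \<le> smooth_max a b'"
    using \<psi>_diff_le[of "a - b'" "a - b"] assms by (simp add: smooth_max_def)
  also have "\<dots> \<le> smooth_max a' b'"
    using \<psi>_mono[of "a - b'" "a' - b'"] assms by (simp add: smooth_max_def)
  finally show ?thesis .
qed

text \<open>The map \<open>(a, b) \<mapsto> b + \<psi> (a - b)\<close> is jointly convex and monotone in both arguments, so it preserves
  convexity; monotonicity in \<open>b\<close> is where the slope of \<open>\<psi>\<close> being at most 1 enters.\<close>

lemma convex_on_smooth_max:
  assumes "convex_on UNIV A" "convex_on UNIV B"
  shows "convex_on UNIV (\<lambda>x. smooth_max (A x) (B x))"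
proof (rule convex_onI)
  fix t :: real and x y :: 'a
  assume t: "0 < t" "t < 1"
  let ?z = "(1 - t) *\<^sub>R x + t *\<^sub>R y"
  let ?a = "(1 - t) * A x + t * A y" and ?b = "(1 - t) * B x + t * B y"
  have "smooth_max (A ?z) (B ?z) \<le> smooth_max ?a ?b"
    using assms t by (intro smooth_max_mono) (simp_all add: convex_onD)
  also have "\<psi> ((1 - t) *\<^sub>R (A x - B x) + t *\<^sub>R (A y - B y))
      \<le> (1 - t) * \<psi> (A x - B x) + t * \<psi> (A y - B y)"
    using convex_onD[OF \<psi>_convex, of t "A x - B x" "A y - B y"] t by simp
  then have "smooth_max ?a ?b \<le> (1 - t) * smooth_max (A x) (B x) + t * smooth_max (A y) (B y)"
    by (simp add: smooth_max_def algebra_simps)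
  finally show "smooth_max (A ?z) (B ?z) \<le>
      (1 - t) * smooth_max (A x) (B x) + t * smooth_max (A y) (B y)" .
qed simp

lemma smooth_expr_smooth_max:
  "smooth_expr A \<Longrightarrow> smooth_expr B \<Longrightarrow> smooth_expr (\<lambda>x. smooth_max (A x) (B x))"
  unfolding smooth_max_def by (intro smooth_expr.add smooth_expr_\<psi> smooth_expr_diff)

lemma has_lipschitz_gradient_smooth_max:
  assumes A: "has_lipschitz_gradient A gA" and B: "has_lipschitz_gradient B gB"
  shows "has_lipschitz_gradient (\<lambda>x. smooth_max (A x) (B x))
    (\<lambda>x. gB x + \<psi>' (A x - B x) *\<^sub>R (gA x - gB x))"
proof -
  let ?p = "\<lambda>x. \<psi>' (A x - B x)" and ?D = "\<lambda>x. gA x - gB x"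
  obtain LA LB MA MB KA KB where
    lip: "LA-lipschitz_on UNIV A" "LB-lipschitz_on UNIV B"
      "MA-lipschitz_on UNIV gA" "MB-lipschitz_on UNIV gB"
    and bd: "\<And>x. norm (gA x) \<le> KA" "\<And>x. norm (gB x) \<le> KB"
    using A B unfolding has_lipschitz_gradient_def by blast
  obtain L\<psi> where L\<psi>: "L\<psi>-lipschitz_on UNIV \<psi>'" using lipschitz_\<psi>' by blast
  have lip_AB: "(LA + LB)-lipschitz_on UNIV (\<lambda>x. A x - B x)"
    and lip_D: "(MA + MB)-lipschitz_on UNIV ?D"
    using lip by (auto intro: lipschitz_on_diff)
  have lip_\<psi>: "1-lipschitz_on UNIV \<psi>"
  proof (rule lipschitz_onI)
    show "dist (\<psi> s) (\<psi> t) \<le> 1 * dist s t" for s t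
      using \<psi>_diff_le[of s t] \<psi>_diff_le[of t s] \<psi>_mono[of s t] \<psi>_mono[of t s]
      by (cases "s \<le> t") (auto simp: dist_real_def)
  qed simp
  have lip_p: "(L\<psi> * (LA + LB))-lipschitz_on UNIV ?p"
    by (rule lipschitz_on_compose2[OF lip_AB lipschitz_on_subset[OF L\<psi>]]) simp
  have bd_D: "norm (?D x) \<le> KA + KB" for x
    using norm_triangle_ineq4[of "gA x" "gB x"] bd[of x] by linarith
  have lip_pD: "(MA + MB + L\<psi> * (LA + LB) * (KA + KB))-lipschitz_on UNIV (\<lambda>x. ?p x *\<^sub>R ?D x)"
  proof (rule lipschitz_onI)
    fix x y
    have "?p x *\<^sub>R ?D x - ?p y *\<^sub>R ?D y = ?p x *\<^sub>R (?D x - ?D y) + (?p x - ?p y) *\<^sub>R ?D y"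
      by (simp add: algebra_simps)
    then have "dist (?p x *\<^sub>R ?D x) (?p y *\<^sub>R ?D y)
        \<le> \<bar>?p x\<bar> * norm (?D x - ?D y) + \<bar>?p x - ?p y\<bar> * norm (?D y)"
      unfolding dist_norm by (metis norm_scaleR norm_triangle_ineq)
    also have "\<dots> \<le> 1 * ((MA + MB) * dist x y) + (L\<psi> * (LA + LB) * dist x y) * (KA + KB)"
    proof (intro add_mono mult_mono)
      show "norm (?D x - ?D y) \<le> (MA + MB) * dist x y"
        using lipschitz_onD[OF lip_D, of x y] by (simp add: dist_norm)
      show "\<bar>?p x - ?p y\<bar> \<le> L\<psi> * (LA + LB) * dist x y"
        using lipschitz_onD[OF lip_p, of x y] by (simp add: dist_norm)
      show "0 \<le> L\<psi> * (LA + LB) * dist x y"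
        using lipschitz_on_nonneg[OF lip_p] by simp
    qed (use \<psi>'_nonneg \<psi>'_le_1 bd_D in auto)
    finally show "dist (?p x *\<^sub>R ?D x) (?p y *\<^sub>R ?D y)
        \<le> (MA + MB + L\<psi> * (LA + LB) * (KA + KB)) * dist x y"
      by (simp add: algebra_simps)
  next
    have "0 \<le> KA + KB" using bd_D norm_ge_zero order_trans by blast
    then show "0 \<le> MA + MB + L\<psi> * (LA + LB) * (KA + KB)"
      using lipschitz_on_nonneg[OF lip_p] lipschitz_on_nonneg[OF lip_D] by simp
  qed
  show ?thesis
    unfolding has_lipschitz_gradient_def
  proof (intro conjI allI exI)
    fix x
    have dA: "(A has_derivative (\<lambda>v. gA x \<bullet> v)) (at x)"
      and dB: "(B has_derivative (\<lambda>v. gB x \<bullet> v)) (at x)"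
      using A B unfolding has_lipschitz_gradient_def by auto
    have "(\<psi> has_derivative (*) (\<psi>' (A x - B x))) (at (A x - B x))"
      using DERIV_\<psi> by (simp add: has_field_derivative_def)
    from has_derivative_add[OF dB has_derivative_compose[OF has_derivative_diff[OF dA dB] this]]
    show "((\<lambda>x. smooth_max (A x) (B x)) has_derivative (\<lambda>v. (gB x + ?p x *\<^sub>R ?D x) \<bullet> v)) (at x)"
      by (simp add: smooth_max_def[abs_def] inner_add_left inner_diff_left)
    show "(LB + 1 * (LA + LB))-lipschitz_on UNIV (\<lambda>x. smooth_max (A x) (B x))"
      unfolding smooth_max_def
      by (intro lipschitz_on_add lip lipschitz_on_compose2[OF lip_AB] lipschitz_on_subset[OF lip_\<psi>]) simp
    show "(MB + (MA + MB + L\<psi> * (LA + LB) * (KA + KB)))-lipschitz_on UNIV (\<lambda>x. gB x + ?p x *\<^sub>R ?D x)"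
      by (intro lipschitz_on_add lip lip_pD)
    have "norm (?p x *\<^sub>R ?D x) \<le> 1 * (KA + KB)"
      unfolding norm_scaleR using \<psi>'_nonneg \<psi>'_le_1 bd_D by (intro mult_mono) auto
    then show "norm (gB x + ?p x *\<^sub>R ?D x) \<le> KB + (KA + KB)"
      by (intro norm_triangle_le add_mono bd) simp
  qed
qed

end

text \<open>A smooth even convex substitute for the absolute value. It is strictly increasing in \<open>\<bar>t\<bar>\<close>, so it
  preserves comparisons of absolute values, and its first two derivatives are bounded. The first
  derivative of the square is unbounded, which would make the Hessian unbounded once the square is
  put inside the ramp.\<close>

definition hyp :: "real \<Rightarrow> real" where "hyp t = sqrt (1 + t\<^sup>2)"

lemma hyp_0: "hyp 0 = 1" by (simp add: hyp_def)

lemma hyp_ge_1: "1 \<le> hyp t" by (simp add: hyp_def)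

lemma hyp_le_iff: "hyp s \<le> hyp t \<longleftrightarrow> \<bar>s\<bar> \<le> \<bar>t\<bar>"
  by (simp add: hyp_def abs_le_square_iff)

lemma hyp_less_iff: "hyp s < hyp t \<longleftrightarrow> \<bar>s\<bar> < \<bar>t\<bar>"
  using hyp_le_iff[of t s] by linarith

lemma DERIV_hyp: "(hyp has_real_derivative t / hyp t) (at t)"
proof -
  have "0 < 1 + t\<^sup>2" by (simp add: add_pos_nonneg)
  then show ?thesis
    unfolding hyp_def by (auto intro!: derivative_eq_intros simp: field_simps)
qed

lemma DERIV_hyp': "((\<lambda>t. t / hyp t) has_real_derivative 1 / (hyp t) ^ 3) (at t)"
proof -
  have "hyp t > 0" using hyp_ge_1[of t] by linarith
  moreover have "hyp t * hyp t = 1 + t * t" by (simp add: hyp_def power2_eq_square)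
  ultimately show ?thesis
    by (auto intro!: derivative_eq_intros DERIV_hyp simp: field_simps power3_eq_cube)
qed

lemma hyp'_mono: "s \<le> t \<Longrightarrow> s / hyp s \<le> t / hyp t"
  by (rule DERIV_nonneg_imp_nondecreasing[where f = "\<lambda>t. t / hyp t"])
    (use DERIV_hyp' hyp_ge_1 in \<open>auto intro!: exI[of _ "1 / (hyp _) ^ 3"] simp: order_trans[OF zero_le_one]\<close>)

lemma hyp_convex: "convex_on UNIV hyp"
  by (rule convex_on_realI[where f' = "\<lambda>t. t / hyp t"]) (auto simp: DERIV_hyp hyp'_mono)

lemma abs_hyp'_le: "\<bar>t / hyp t\<bar> \<le> 1"
proof -
  have "\<bar>t\<bar> \<le> hyp t" by (simp add: hyp_def real_le_rsqrt)
  then show ?thesis using hyp_ge_1[of t] by (simp add: divide_simps)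
qed

lemma hyp'_lipschitz: "\<bar>s / hyp s - t / hyp t\<bar> \<le> \<bar>s - t\<bar>"
proof -
  have "norm (1 / hyp z ^ 3) \<le> 1" for z
  proof -
    have "1 \<le> hyp z ^ 3" by (rule one_le_power[OF hyp_ge_1])
    then show ?thesis using hyp_ge_1[of z] by (simp add: divide_le_eq)
  qed
  then show ?thesis
    using field_differentiable_bound[of UNIV "\<lambda>t. t / hyp t" "\<lambda>t. 1 / (hyp t) ^ 3" 1 s t]
      DERIV_hyp' by simp
qed

lemma hyp_lipschitz: "\<bar>hyp s - hyp t\<bar> \<le> \<bar>s - t\<bar>"
  using field_differentiable_bound[of UNIV "hyp" "\<lambda>t. t / hyp t" 1 s t]
    DERIV_hyp abs_hyp'_le by simp

text \<open>The square root is smooth on the positive axis only, hence the list of derivatives of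
  \<open>y powr (1/2)\<close> on \<open>{0<..}\<close>.\<close>

lemma smooth_expr_hyp:
  assumes "smooth_expr f"
  shows "smooth_expr (\<lambda>x. hyp (f x))"
proof -
  define d where "d k y = (\<Prod>i<k. 1 / 2 - real i) * y powr (1 / 2 - real k)" for k y
  have "smooth_expr (\<lambda>x. d 0 (1 + f x * f x))"
  proof (rule smooth_expr.comp[where U = "{0<..}" and d = d])
    show "smooth_expr (\<lambda>x. 1 + f x * f x)"
      by (intro smooth_expr.add smooth_expr.mult smooth_expr.const assms)
    show "1 + f x * f x \<in> {0<..}" for x by (simp add: add_pos_nonneg)
    show "(d k has_real_derivative d (Suc k) y) (at y)" if "y \<in> {0<..}" for k y
      unfolding d_def using that by (auto intro!: derivative_eq_intros simp: algebra_simps)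
  qed
  then show ?thesis
    by (simp add: d_def hyp_def powr_half_sqrt power2_eq_square add_nonneg_nonneg)
qed

lemma norm_axis: "norm (axis i a :: real^'n) = \<bar>a\<bar>" for i :: "'n::finite"
proof -
  have "axis i a = a *\<^sub>R (axis i 1 :: real^'n)" by (simp add: vec_eq_iff axis_def)
  then show ?thesis by simp
qed

lemma convex_on_hyp_coordinate:
  "convex_on UNIV (\<lambda>x :: real^'n. hyp (c * x $ i))"
proof (rule convex_onI)
  fix t :: real and x y :: "real^'n"
  assume "0 < t" "t < 1"
  then show "hyp (c * ((1 - t) *\<^sub>R x + t *\<^sub>R y) $ i) \<le> (1 - t) * hyp (c * x $ i) + t * hyp (c * y $ i)"
    using convex_onD[OF hyp_convex, of t "c * x $ i" "c * y $ i"] by (simp add: algebra_simps)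
qed simp

lemma has_lipschitz_gradient_hyp_coordinate:
  fixes i :: "'n::finite"
  shows "has_lipschitz_gradient (\<lambda>x :: real^'n. hyp (c * x $ i))
    (\<lambda>x. axis i (c * ((c * x $ i) / hyp (c * x $ i))))"
  unfolding has_lipschitz_gradient_def
proof (intro conjI allI exI)
  fix x :: "real^'n"
  have "(hyp has_derivative (*) ((c * x $ i) / hyp (c * x $ i))) (at (c * x $ i))"
    using DERIV_hyp by (simp add: has_field_derivative_def)
  moreover have "((\<lambda>x. c * x $ i) has_derivative (\<lambda>v. c * v $ i)) (at x)"
    by (intro bounded_linear_imp_has_derivative bounded_linear_const_mult bounded_linear_vec_nth)
  ultimately have "((\<lambda>x. hyp (c * x $ i)) has_derivative
      (\<lambda>v. (c * x $ i) / hyp (c * x $ i) * (c * v $ i))) (at x)"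
    by (rule has_derivative_compose[rotated])
  then show "((\<lambda>x. hyp (c * x $ i)) has_derivative
      (\<lambda>v. axis i (c * ((c * x $ i) / hyp (c * x $ i))) \<bullet> v)) (at x)"
    by (simp add: inner_axis' mult_ac)
  have "norm (axis i (c * ((c * x $ i) / hyp (c * x $ i)))) = \<bar>c\<bar> * \<bar>(c * x $ i) / hyp (c * x $ i)\<bar>"
    by (simp add: norm_axis abs_mult)
  also have "\<dots> \<le> \<bar>c\<bar> * 1" by (intro mult_left_mono abs_hyp'_le) simp
  finally show "norm (axis i (c * ((c * x $ i) / hyp (c * x $ i)))) \<le> \<bar>c\<bar>" by simp
next
  show "\<bar>c\<bar>-lipschitz_on UNIV (\<lambda>x :: real^'n. hyp (c * x $ i))"
  proof (rule lipschitz_onI)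
    fix x y :: "real^'n"
    have "\<bar>hyp (c * x $ i) - hyp (c * y $ i)\<bar> \<le> \<bar>c * x $ i - c * y $ i\<bar>"
      by (rule hyp_lipschitz)
    also have "\<dots> = \<bar>c\<bar> * \<bar>(x - y) $ i\<bar>" by (simp add: right_diff_distrib flip: abs_mult)
    also have "\<dots> \<le> \<bar>c\<bar> * norm (x - y)" by (intro mult_left_mono component_le_norm_cart) simp
    finally show "dist (hyp (c * x $ i)) (hyp (c * y $ i)) \<le> \<bar>c\<bar> * dist x y"
      by (simp add: dist_norm)
  qed simp
  show "(\<bar>c\<bar> * \<bar>c\<bar>)-lipschitz_on UNIV (\<lambda>x :: real^'n. axis i (c * ((c * x $ i) / hyp (c * x $ i))))"
  proof (rule lipschitz_onI)
    fix x y :: "real^'n"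
    let ?h = "\<lambda>x :: real^'n. (c * x $ i) / hyp (c * x $ i)"
    have "axis i (c * ?h x) - axis i (c * ?h y) = axis i (c * (?h x - ?h y))"
      by (simp add: vec_eq_iff axis_def right_diff_distrib)
    then have "dist (axis i (c * ?h x)) (axis i (c * ?h y)) = \<bar>c\<bar> * \<bar>?h x - ?h y\<bar>"
      by (simp only: dist_norm norm_axis real_norm_def abs_mult)
    also have "\<dots> \<le> \<bar>c\<bar> * \<bar>c * x $ i - c * y $ i\<bar>"
      by (intro mult_left_mono hyp'_lipschitz) simp
    also have "\<bar>c * x $ i - c * y $ i\<bar> = \<bar>c\<bar> * \<bar>(x - y) $ i\<bar>"
      by (simp add: right_diff_distrib flip: abs_mult)
    also have "\<bar>c\<bar> * (\<bar>c\<bar> * \<bar>(x - y) $ i\<bar>) \<le> \<bar>c\<bar> * (\<bar>c\<bar> * norm (x - y))"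
      by (intro mult_left_mono component_le_norm_cart) simp_all
    finally show "dist (axis i (c * ?h x)) (axis i (c * ?h y)) \<le> \<bar>c\<bar> * \<bar>c\<bar> * dist x y"
      by (simp add: dist_norm mult.assoc)
  qed simp
qed

section \<open>The adversarial function\<close>

text \<open>\<open>\<iota>\<close> lists the coordinates in the order in which they attain the bound.\<close>

locale adversary = ramp \<delta> \<psi> \<psi>' for \<delta> :: real and \<psi> \<psi>' :: "real \<Rightarrow> real" +
  fixes \<theta> :: real and \<iota> :: "nat \<Rightarrow> 'n::finite" and N :: nat
  assumes \<theta>_pos: "0 < \<theta>"
    and \<iota>_bij: "bij_betw \<iota> {..<N} UNIV"
begin

text \<open>\<open>minorant k\<close> is the smoothed maximum of \<open>h (\<theta> x\<^sub>0), \<dots>, h (\<theta> x\<^sub>k\<^sub>-\<^sub>1)\<close>, where the start value 1 is the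
  minimum of \<open>h\<close>. It does not exceed \<open>h (\<theta> \<parallel>x\<parallel>)\<close>, hence the name. The newest coordinate is the
  second argument, so that it enters without loss, while each older one has lost at most \<open>\<delta>\<close> per
  later step.\<close>

primrec minorant :: "nat \<Rightarrow> real^'n \<Rightarrow> real" where
  "minorant 0 x = 1"
| "minorant (Suc k) x = smooth_max (minorant k x) (hyp (\<theta> * x $ \<iota> k))"

definition F :: "real^'n \<Rightarrow> real" where
  "F x = (\<Sum>i<N. smooth_max (hyp (x $ \<iota> i)) (minorant i x))"

primrec grad_minorant :: "nat \<Rightarrow> real^'n \<Rightarrow> real^'n" where
  "grad_minorant 0 x = 0"
| "grad_minorant (Suc k) x =
    axis (\<iota> k) (\<theta> * ((\<theta> * x $ \<iota> k) / hyp (\<theta> * x $ \<iota> k))) +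
    \<psi>' (minorant k x - hyp (\<theta> * x $ \<iota> k)) *\<^sub>R
      (grad_minorant k x - axis (\<iota> k) (\<theta> * ((\<theta> * x $ \<iota> k) / hyp (\<theta> * x $ \<iota> k))))"

definition grad_summand :: "nat \<Rightarrow> real^'n \<Rightarrow> real^'n" where
  "grad_summand i x = grad_minorant i x +
     \<psi>' (hyp (x $ \<iota> i) - minorant i x) *\<^sub>R (axis (\<iota> i) (x $ \<iota> i / hyp (x $ \<iota> i)) - grad_minorant i x)"

lemma \<iota>_eq_iff: "i < N \<Longrightarrow> k < N \<Longrightarrow> \<iota> i = \<iota> k \<longleftrightarrow> i = k"
  using \<iota>_bij by (auto simp: bij_betw_def inj_on_def)

lemma \<iota>_cases: obtains i where "i < N" "m = \<iota> i"
  using \<iota>_bij by (auto simp: bij_betw_def image_iff set_eq_iff)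

lemma convex_F: "convex_on UNIV F"
proof -
  have minorant: "convex_on UNIV (minorant k)" for k
    by (induction k) (simp_all add: convex_on_const convex_on_smooth_max convex_on_hyp_coordinate)
  have "convex_on UNIV (\<lambda>x. hyp (x $ \<iota> i))" for i
    using convex_on_hyp_coordinate[of 1 "\<iota> i"] by simp
  with minorant have summand: "convex_on UNIV (\<lambda>x. smooth_max (hyp (x $ \<iota> i)) (minorant i x))" for i
    by (intro convex_on_smooth_max)
  have "convex_on UNIV (\<lambda>x. \<Sum>i<n. smooth_max (hyp (x $ \<iota> i)) (minorant i x))" for n
    by (induction n) (simp_all add: convex_on_const convex_on_add summand)
  then show ?thesis by (simp add: F_def[abs_def])
qed

lemma smooth_F: "smooth F"
proof -
  have coord: "smooth_expr (\<lambda>x :: real^'n. x $ i)" for i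
    by (intro smooth_expr.linear bounded_linear_vec_nth)
  have minorant: "smooth_expr (minorant k)" for k
    by (induction k)
      (simp_all add: smooth_expr.const smooth_expr_smooth_max smooth_expr_hyp smooth_expr.mult coord)
  have "smooth_expr F"
    unfolding F_def[abs_def]
    by (intro smooth_expr_sum smooth_expr_smooth_max minorant smooth_expr_hyp coord)
  then show ?thesis by (rule smooth_expr_imp_smooth)
qed

lemma F_has_lipschitz_gradient: "has_lipschitz_gradient F (\<lambda>x. \<Sum>i<N. grad_summand i x)"
proof -
  have minorant: "has_lipschitz_gradient (minorant k) (grad_minorant k)" for k
  proof (induction k)
    case (Suc k)
    from has_lipschitz_gradient_smooth_max[OF this
        has_lipschitz_gradient_hyp_coordinate[of \<theta> "\<iota> k"]]
    show ?case by simp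
  qed (simp add: has_lipschitz_gradient_const)
  have "has_lipschitz_gradient (\<lambda>x. hyp (x $ \<iota> i)) (\<lambda>x. axis (\<iota> i) (x $ \<iota> i / hyp (x $ \<iota> i)))" for i
    using has_lipschitz_gradient_hyp_coordinate[of 1 "\<iota> i"] by simp
  with minorant show ?thesis
    unfolding F_def[abs_def] grad_summand_def
    by (intro has_lipschitz_gradient_sum has_lipschitz_gradient_smooth_max)
qed

lemma partial_deriv_F: "partial_deriv F m x = (\<Sum>i<N. grad_summand i x $ m)"
  using fun_cong[OF has_lipschitz_gradient_imp_grad[OF F_has_lipschitz_gradient], of x]
  by (simp add: grad_def vec_eq_iff)

lemma minorant_ge_1: "1 \<le> minorant k x"
  by (cases k) (simp_all add: order_trans[OF hyp_ge_1 smooth_max_ge(1)])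

lemma minorant_le: "minorant k x \<le> hyp (\<theta> * infnorm x)"
proof (induction k)
  case (Suc k)
  have "hyp (\<theta> * x $ \<iota> k) \<le> hyp (\<theta> * infnorm x)"
    using \<theta>_pos component_le_infnorm_cart[of x "\<iota> k"]
    by (simp add: hyp_le_iff abs_mult infnorm_pos_le)
  with Suc show ?case
    using smooth_max_le[of "minorant k x" "hyp (\<theta> * x $ \<iota> k)"] by simp
qed (simp add: hyp_ge_1)

lemma minorant_ge:
  assumes "j < k" shows "hyp (\<theta> * x $ \<iota> j) - real (k - Suc j) * \<delta> \<le> minorant k x"
proof -
  have "hyp (\<theta> * x $ \<iota> j) - real l * \<delta> \<le> minorant (Suc j + l) x" for l
  proof (induction l)
    case (Suc l)
    then show ?case
      using smooth_max_ge(2)[of "minorant (Suc j + l) x" "hyp (\<theta> * x $ \<iota> (Suc j + l))"]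
      by (simp add: algebra_simps)
  qed (use smooth_max_ge(1) in simp)
  from this[of "k - Suc j"] assms show ?thesis by simp
qed

text \<open>Every summand is at least 1, with equality at the origin. If \<open>x\<^sub>i \<noteq> 0\<close> then the \<open>i\<close>-th summand
  exceeds 1, through its inner maximum or else through \<open>h (x\<^sub>i)\<close>.\<close>

lemma F_minimum:
  assumes "x \<noteq> 0" shows "F 0 < F x"
proof -
  have minorant_0: "minorant k 0 = 1" for k
    by (induction k) (simp_all add: smooth_max_def hyp_0 \<psi>_eq_0)
  have F_0: "F 0 = (\<Sum>i<N. 1)"
    by (simp add: F_def minorant_0 hyp_0 smooth_max_def \<psi>_eq_0)
  obtain i where i: "i < N" "x $ \<iota> i \<noteq> 0"
    using assms by (metis \<iota>_cases vec_eq_iff zero_index)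
  have "1 < smooth_max (hyp (x $ \<iota> i)) (minorant i x)"
  proof (cases "minorant i x = 1")
    case True
    have "hyp 0 < hyp (x $ \<iota> i)" using i by (subst hyp_less_iff) simp
    with True show ?thesis using \<psi>_pos by (simp add: smooth_max_def hyp_0)
  next
    case False
    with minorant_ge_1[of i x] smooth_max_ge(1)[of "minorant i x" "hyp (x $ \<iota> i)"] show ?thesis by simp
  qed
  then show ?thesis
    unfolding F_0 unfolding F_def using i(1) order_trans[OF minorant_ge_1 smooth_max_ge(1)]
    by (intro sum_strict_mono_ex1) auto
qed

text \<open>Each partial derivative is a nonnegative multiple of the coordinate itself, since this holds for
  \<open>h\<close> and passes to the convex combination that forms the gradient of a smoothed maximum. The
  multiple, rather than a bare sign condition, also covers coordinates that are zero.\<close>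

lemma grad_minorant_sign: "\<exists>q\<ge>0. grad_minorant k x $ m = q * x $ m"
proof (induction k)
  case (Suc k)
  then obtain q where q: "q \<ge> 0" "grad_minorant k x $ m = q * x $ m" by blast
  let ?p = "\<psi>' (minorant k x - hyp (\<theta> * x $ \<iota> k))"
  let ?a = "if m = \<iota> k then \<theta> * \<theta> / hyp (\<theta> * x $ \<iota> k) else 0"
  have "?a \<ge> 0" using order_trans[OF zero_le_one hyp_ge_1] by simp
  moreover have "grad_minorant (Suc k) x $ m = ((1 - ?p) * ?a + ?p * q) * x $ m"
    using q(2) by (simp add: axis_def algebra_simps)
  ultimately show ?case
    using q(1) \<psi>'_nonneg \<psi>'_le_1
    by (intro exI[of _ "(1 - ?p) * ?a + ?p * q"] conjI add_nonneg_nonneg mult_nonneg_nonneg) simp_all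
qed (auto intro: exI[of _ 0])

lemma grad_minorant_eq_0_fresh:
  assumes "i < N" "k \<le> i" shows "grad_minorant k x $ \<iota> i = 0"
  using assms(2)
proof (induction k)
  case (Suc k)
  with assms(1) show ?case by (simp add: axis_def \<iota>_eq_iff)
qed simp

text \<open>Coordinate \<open>i\<close> enters the minorant once. If the older coordinates dominate it by \<open>\<delta>\<close> at that moment,
  the ramp has slope exactly 1 and the dependence on \<open>x\<^sub>i\<close> cancels for good.\<close>

lemma grad_minorant_eq_0:
  assumes "i < N" "k \<le> N" "\<delta> \<le> minorant i x - hyp (\<theta> * x $ \<iota> i)"
  shows "grad_minorant k x $ \<iota> i = 0"
  using assms(2)
proof (induction k)
  case (Suc k)
  then show ?case
    using assms(1) \<psi>'_eq_1[OF assms(3)] by (cases "k = i") (simp_all add: axis_def \<iota>_eq_iff)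
qed simp

lemma grad_summand_sign: "\<exists>q\<ge>0. grad_summand i x $ m = q * x $ m"
proof -
  obtain q where q: "q \<ge> 0" "grad_minorant i x $ m = q * x $ m" using grad_minorant_sign by blast
  let ?p = "\<psi>' (hyp (x $ \<iota> i) - minorant i x)"
  let ?a = "if m = \<iota> i then 1 / hyp (x $ \<iota> i) else 0"
  have "?a \<ge> 0" using order_trans[OF zero_le_one hyp_ge_1] by simp
  moreover have "grad_summand i x $ m = ((1 - ?p) * q + ?p * ?a) * x $ m"
    using q(2) by (simp add: grad_summand_def axis_def algebra_simps)
  ultimately show ?thesis
    using q(1) \<psi>'_nonneg \<psi>'_le_1
    by (intro exI[of _ "(1 - ?p) * q + ?p * ?a"] conjI add_nonneg_nonneg mult_nonneg_nonneg) simp_all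
qed

lemma partial_deriv_F_sign: "\<exists>q\<ge>0. partial_deriv F m x = q * x $ m"
proof -
  obtain q where q: "\<And>i. q i \<ge> 0" "\<And>i. grad_summand i x $ m = q i * x $ m"
    using grad_summand_sign[of _ x m] by metis
  then show ?thesis
    by (intro exI[of _ "\<Sum>i<N. q i"]) (auto simp: partial_deriv_F sum_distrib_right intro: sum_nonneg)
qed

text \<open>The \<open>i\<close>-th summand contributes strictly, the minorant inside it being independent of \<open>x\<^sub>i\<close>; the other
  summands do not pull in the opposite direction.\<close>

lemma partial_deriv_F_pos:
  assumes "i < N" "minorant i x < hyp (x $ \<iota> i)"
  shows "0 < partial_deriv F (\<iota> i) x * x $ \<iota> i"
proof -
  have nz: "x $ \<iota> i \<noteq> 0" using assms(2) minorant_ge_1[of i x] hyp_0 by auto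
  have "grad_summand i x $ \<iota> i * x $ \<iota> i
      = \<psi>' (hyp (x $ \<iota> i) - minorant i x) * ((x $ \<iota> i)\<^sup>2 / hyp (x $ \<iota> i))"
    using grad_minorant_eq_0_fresh[OF assms(1) order_refl]
    by (simp add: grad_summand_def axis_def power2_eq_square)
  also have "\<dots> > 0"
    using nz assms(2) \<psi>'_pos hyp_ge_1[of "x $ \<iota> i"] by (intro mult_pos_pos divide_pos_pos) auto
  finally have "0 < (\<Sum>k<N. grad_summand k x $ \<iota> i * x $ \<iota> i)"
  proof (rule sum_pos2[rotated 2])
    show "0 \<le> grad_summand k x $ \<iota> i * x $ \<iota> i" for k
      using grad_summand_sign[of k x "\<iota> i"] by (auto simp: mult.assoc)
  qed (use assms(1) in auto)
  then show ?thesis by (simp add: partial_deriv_F sum_distrib_right)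
qed

text \<open>The source of ties: the first condition switches off \<open>x\<^sub>i\<close> in the \<open>i\<close>-th summand, the second one
  in all later summands, and the earlier ones do not contain \<open>x\<^sub>i\<close>.\<close>

lemma partial_deriv_F_eq_0:
  assumes "i < N" "hyp (x $ \<iota> i) \<le> minorant i x" "\<delta> \<le> minorant i x - hyp (\<theta> * x $ \<iota> i)"
  shows "partial_deriv F (\<iota> i) x = 0"
proof -
  have "grad_summand k x $ \<iota> i = 0" if "k < N" for k
    using grad_minorant_eq_0[OF assms(1) _ assms(3), of k] that assms(1,2) \<psi>'_eq_0
    by (cases "k = i") (simp_all add: grad_summand_def axis_def \<iota>_eq_iff)
  then show ?thesis by (simp add: partial_deriv_F)
qed

lemma F_in_M_class: "F \<in> M_class \<theta>"
  unfolding M_class_def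
proof (intro CollectI conjI allI impI)
  show "F differentiable (at x)" for x
    using F_has_lipschitz_gradient unfolding has_lipschitz_gradient_def differentiable_def by blast
next
  fix x :: "real^'n" and m
  assume large: "\<theta> * infnorm x < \<bar>x $ m\<bar>"
  obtain i where i: "i < N" "m = \<iota> i" by (rule \<iota>_cases)
  have "hyp (\<theta> * infnorm x) < hyp (x $ m)"
    using large \<theta>_pos by (simp add: hyp_less_iff abs_mult infnorm_pos_le)
  with minorant_le[of i x] i show "0 < partial_deriv F m x * x $ m"
    by (simp add: partial_deriv_F_pos)
qed

end

section \<open>The scalar recursion\<close>

lemma power_le_bound: "bound \<beta> \<theta> k \<ge> \<beta> ^ k"
proof (induction k)
  case (Suc k)
  then show ?case by (simp add: le_max_iff_disj algebra_simps)
qed simp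

lemma bound_Suc_before:
  assumes "0 < \<beta>" "\<theta> < 1" "\<not> reaches_threshold \<beta> \<theta> k"
  shows "bound \<beta> \<theta> (Suc k) = \<theta> * bound \<beta> \<theta> k + (1 - \<beta>) * \<beta> ^ k"
proof -
  have "bound \<beta> \<theta> k * (1 - \<theta>) < 2 * (1 - \<beta>) * \<beta> ^ k"
    using assms by (simp add: reaches_threshold_def divide_simps mult_ac split: if_splits)
  then show ?thesis by (simp add: algebra_simps max_def)
qed

lemma bound_Suc_after:
  assumes "0 < \<beta>" "\<theta> < 1" "reaches_threshold \<beta> \<theta> k"
  shows "bound \<beta> \<theta> (Suc k) = bound \<beta> \<theta> k - (1 - \<beta>) * \<beta> ^ k"
proof -
  have "2 * (1 - \<beta>) * \<beta> ^ k \<le> bound \<beta> \<theta> k * (1 - \<theta>)"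
    using assms by (simp add: reaches_threshold_def divide_simps mult_ac split: if_splits)
  then show ?thesis by (simp add: algebra_simps max_def)
qed

text \<open>Past the threshold the ratio \<open>\<rho> = b\<^sub>k / \<beta>\<^sup>k\<close> is mapped to \<open>(\<rho> - (1 - \<beta>)) / \<beta>\<close>, which is at least \<open>\<rho>\<close> for
  \<open>\<rho> \<ge> 1\<close>; the threshold is above 1 because \<open>\<theta> > 2 \<beta> - 1\<close>.\<close>

lemma reaches_threshold_Suc:
  assumes "0 < \<beta>" "\<beta> < 1" "\<theta> < 1" "2 * \<beta> - 1 < \<theta>" and k: "reaches_threshold \<beta> \<theta> k"
  shows "reaches_threshold \<beta> \<theta> (Suc k)"
proof -
  define T where "T = 2 * (1 - \<beta>) / (1 - \<theta>)"
  have "T * (1 - \<beta>) \<ge> 1 * (1 - \<beta>)"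
    using assms by (intro mult_right_mono) (simp_all add: T_def)
  then have "T * \<beta> \<le> T - (1 - \<beta>)" by (simp add: algebra_simps)
  then have "T * \<beta> * \<beta> ^ k \<le> (T - (1 - \<beta>)) * \<beta> ^ k"
    using assms(1) by (intro mult_right_mono) auto
  also have "T \<le> bound \<beta> \<theta> k / \<beta> ^ k"
    using k by (simp only: reaches_threshold_def T_def)
  then have "T * \<beta> ^ k \<le> bound \<beta> \<theta> k" using assms(1) by (simp add: pos_le_divide_eq)
  then have "(T - (1 - \<beta>)) * \<beta> ^ k \<le> bound \<beta> \<theta> k - (1 - \<beta>) * \<beta> ^ k"
    by (simp add: algebra_simps)
  also have "\<dots> = bound \<beta> \<theta> (Suc k)"
    using bound_Suc_after assms by simp
  finally have "T \<le> bound \<beta> \<theta> (Suc k) / \<beta> ^ Suc k"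
    using assms(1) by (simp add: pos_le_divide_eq mult_ac del: bound.simps)
  then show ?thesis by (simp only: reaches_threshold_def T_def)
qed

text \<open>Below the threshold \<open>T\<close> the ratio \<open>\<rho> = b\<^sub>k / \<beta>\<^sup>k\<close> grows by \<open>((\<theta> - \<beta>) \<rho> + (1 - \<beta>)) / \<beta>\<close> per step. This is affine in
  \<open>\<rho>\<close> and positive at both ends of \<open>[1, T]\<close>, so it is bounded below by a positive constant and the ratio
  could not stay bounded.\<close>

lemma reaches_threshold_exists:
  assumes \<beta>: "0 < \<beta>" "\<beta> < 1" and \<theta>: "\<theta> < 1" "2 * \<beta> - 1 < \<theta>"
  shows "\<exists>k. reaches_threshold \<beta> \<theta> k"
proof (rule ccontr)
  assume never: "\<not> ?thesis"
  define T where "T = 2 * (1 - \<beta>) / (1 - \<theta>)"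
  define \<rho> where "\<rho> k = bound \<beta> \<theta> k / \<beta> ^ k" for k
  define u where "u = 1 + \<theta> - 2 * \<beta>"
  \<comment> \<open>the smaller of the values of the increment at the ends 1 and \<open>T\<close>\<close>
  define \<eta> where "\<eta> = min u (u * (1 - \<beta>) / (1 - \<theta>)) / \<beta>"
  have "u > 0" using \<theta> by (simp add: u_def)
  then have "\<eta> > 0" using \<beta> \<theta> by (simp add: \<eta>_def)
  have \<rho>_less: "\<rho> k < T" for k
    using never by (auto simp: reaches_threshold_def \<rho>_def T_def not_le)
  have \<rho>_ge: "\<rho> k \<ge> 1" for k
    using power_le_bound[where k = k] \<beta> by (simp add: \<rho>_def)
  have \<rho>_step: "\<rho> k + \<eta> \<le> \<rho> (Suc k)" for k
  proof -
    have "\<rho> (Suc k) = (\<theta> * \<rho> k + (1 - \<beta>)) / \<beta>"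
      using bound_Suc_before[of \<beta> \<theta> k] never \<beta> \<theta> by (simp add: \<rho>_def field_simps del: bound.simps)
    then have "\<beta> * (\<rho> (Suc k) - \<rho> k) = (\<theta> - \<beta>) * \<rho> k + (1 - \<beta>)"
      using \<beta> by (simp add: field_simps)
    also have "\<dots> \<ge> \<beta> * \<eta>"
    proof (cases "\<theta> \<ge> \<beta>")
      case True
      then have "(\<theta> - \<beta>) * 1 \<le> (\<theta> - \<beta>) * \<rho> k" using \<rho>_ge by (intro mult_left_mono) auto
      moreover have "\<beta> * \<eta> \<le> u" using \<beta> by (simp add: \<eta>_def)
      ultimately show ?thesis by (simp add: u_def)
    next
      case False
      then have "(\<theta> - \<beta>) * T \<le> (\<theta> - \<beta>) * \<rho> k"
        using \<rho>_less[of k] by (intro mult_left_mono_neg) auto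
      moreover have "\<beta> * \<eta> \<le> u * (1 - \<beta>) / (1 - \<theta>)" using \<beta> by (simp add: \<eta>_def)
      moreover have "(\<theta> - \<beta>) * T + (1 - \<beta>) = u * (1 - \<beta>) / (1 - \<theta>)"
        using \<theta> by (simp add: T_def u_def field_simps)
      ultimately show ?thesis by simp
    qed
    finally have "\<beta> * \<eta> \<le> \<beta> * (\<rho> (Suc k) - \<rho> k)" .
    then show ?thesis using \<beta> by simp
  qed
  have "\<rho> 0 + real k * \<eta> \<le> \<rho> k" for k
  proof (induction k)
    case (Suc k)
    with \<rho>_step[of k] show ?case by (simp add: algebra_simps)
  qed simp
  moreover obtain k where "T - \<rho> 0 < real k * \<eta>"
    using reals_Archimedean3[OF \<open>\<eta> > 0\<close>] by blast
  ultimately have "T < \<rho> k"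
    by (smt (verit))
  with \<rho>_less[of k] show False by simp
qed

lemma cube_sign_Suc:
  "\<exists>h. cube_sign \<beta> f \<tau> c (Suc k) = cube_sign \<beta> f \<tau> c k -
     ((1 - \<beta>) * \<beta> ^ k) *\<^sub>R chosen_signs f \<tau> h (cube_sign \<beta> f \<tau> c k)"
  by (intro exI[of _ "fst (cube_sign_state \<beta> f \<tau> c k)"])
    (simp add: cube_sign_def Let_def split: prod.split)

lemma chosen_signs_cases: "tie_rule \<tau> \<Longrightarrow> chosen_signs f \<tau> h c $ i \<in> {-1, 1}"
  by (auto simp: chosen_signs_def tie_rule_def sgn_if)

lemma chosen_signs_M_class:
  assumes "f \<in> M_class \<theta>" "\<theta> * infnorm c < \<bar>c $ i\<bar>"
  shows "chosen_signs f \<tau> h c $ i = sgn (c $ i)"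
proof -
  have "0 < partial_deriv f i c * c $ i" using assms by (simp add: M_class_def)
  then show ?thesis
    by (auto simp: chosen_signs_def zero_less_mult_iff)
qed

lemma infnorm_le_iff: "infnorm (x :: real^'n) \<le> b \<longleftrightarrow> (\<forall>i. \<bar>x $ i\<bar> \<le> b)"
proof
  assume "infnorm x \<le> b"
  then show "\<forall>i. \<bar>x $ i\<bar> \<le> b" using component_le_infnorm_cart order_trans by blast
next
  assume "\<forall>i. \<bar>x $ i\<bar> \<le> b"
  then show "infnorm x \<le> b" unfolding infnorm_cart by (intro cSup_least) auto
qed

text \<open>This holds for every function of the class and every tie rule, and leaves only the lower bound to
  be arranged by the adversary.\<close>

lemma infnorm_cube_sign_le:
  assumes \<beta>: "0 \<le> \<beta>" "\<beta> \<le> 1" and \<theta>: "0 \<le> \<theta>"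
    and f: "f \<in> M_class \<theta>" and \<tau>: "tie_rule \<tau>" and c: "infnorm c \<le> 1"
  shows "infnorm (cube_sign \<beta> f \<tau> c k) \<le> bound \<beta> \<theta> k"
proof (induction k)
  case 0
  with c show ?case by (simp add: cube_sign_def)
next
  case (Suc k)
  let ?x = "cube_sign \<beta> f \<tau> c k" and ?w = "(1 - \<beta>) * \<beta> ^ k" and ?b = "bound \<beta> \<theta> k"
  have w: "0 \<le> ?w" using \<beta> by simp
  have b: "0 \<le> ?b" using power_le_bound[of \<beta> k \<theta>] \<beta> by (meson order_trans zero_le_power)
  obtain h where step: "cube_sign \<beta> f \<tau> c (Suc k) = ?x - ?w *\<^sub>R chosen_signs f \<tau> h ?x"
    using cube_sign_Suc by blast
  show ?case unfolding infnorm_le_iff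
  proof
    fix i
    let ?s = "chosen_signs f \<tau> h ?x $ i"
    have x: "\<bar>?x $ i\<bar> \<le> ?b" using Suc by (simp add: infnorm_le_iff)
    have "0 \<le> \<theta> * ?b" using \<theta> b by simp
    have "\<bar>?x $ i - ?w * ?s\<bar> \<le> max (?b - ?w) (\<theta> * ?b + ?w)"
    proof (cases "\<theta> * infnorm ?x < \<bar>?x $ i\<bar>")
      case True
      have "?x $ i \<noteq> 0" using True \<theta> infnorm_pos_le[of ?x] by (metis abs_zero mult_nonneg_nonneg not_less)
      then have "?s = 1 \<and> 0 < ?x $ i \<or> ?s = -1 \<and> ?x $ i < 0"
        using chosen_signs_M_class[OF f True, of \<tau> h] by (auto simp: sgn_if)
      then show ?thesis using x w \<open>0 \<le> \<theta> * ?b\<close> by auto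
    next
      case False
      then have "\<bar>?x $ i\<bar> \<le> \<theta> * ?b" using mult_left_mono[OF Suc \<theta>] by linarith
      then show ?thesis using chosen_signs_cases[OF \<tau>, of f h ?x i] w by auto
    qed
    then show "\<bar>cube_sign \<beta> f \<tau> c (Suc k) $ i\<bar> \<le> bound \<beta> \<theta> (Suc k)" by (simp add: step)
  qed
qed

lemma finite_positive_lower_bound:
  assumes "finite A" "\<And>a. a \<in> A \<Longrightarrow> 0 < (a :: real)"
  shows "\<exists>\<epsilon>>0. \<forall>a\<in>A. \<epsilon> \<le> a"
proof -
  have "0 < Min (insert 1 A)" using assms by (subst Min_gr_iff) auto
  moreover have "\<forall>a\<in>A. Min (insert 1 A) \<le> a" using assms(1) by simp
  ultimately show ?thesis by blast
qed

section \<open>Attaining the bound\<close>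

text \<open>The constant tie rule \<open>-1\<close> moves a coordinate up at every tie, and this is the choice that suits
  the waiting coordinates; after its turn, a coordinate is kept below the bound by
  \<open>infnorm_cube_sign_le\<close>, whatever its ties.\<close>

lemma adversarial_instance:
  fixes \<beta> \<theta> :: real
  assumes \<beta>: "0 < \<beta>" "\<beta> < 1" and \<theta>: "0 < \<theta>" "\<theta> < 1" "2 * \<beta> - 1 < \<theta>"
    and card: "CARD('n::finite) = J_index \<beta> \<theta> + 1"
  shows "\<exists>(F :: real^'n \<Rightarrow> real) (c0 :: real^'n).
    convex_on UNIV F \<and> smooth F \<and> (\<exists>L. L-lipschitz_on UNIV (grad F)) \<and>
    (\<forall>x. x \<noteq> 0 \<longrightarrow> F 0 < F x) \<and> (\<forall>i. c0 $ i \<in> {-1..1}) \<and> F \<in> M_class \<theta> \<and>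
    (\<exists>\<tau>. tie_rule \<tau> \<and> (\<forall>k. infnorm (cube_sign \<beta> F \<tau> c0 k) = bound \<beta> \<theta> k))"
proof -
  define J where "J = J_index \<beta> \<theta>"
  define b where "b = bound \<beta> \<theta>"
  define w where "w k = (1 - \<beta>) * \<beta> ^ k" for k
  have ex: "\<exists>k. reaches_threshold \<beta> \<theta> k"
    using reaches_threshold_exists \<beta> \<theta> by blast
  have before: "b (Suc k) = \<theta> * b k + w k" if "k < J" for k
    using that not_less_Least[of k "reaches_threshold \<beta> \<theta>"] \<beta> \<theta>
    by (simp add: b_def w_def J_def J_index_def bound_Suc_before del: bound.simps)
  have "reaches_threshold \<beta> \<theta> k" if "J \<le> k" for k
    using that
  proof (induction rule: dec_induct)
    case base
    show ?case using LeastI_ex[OF ex] by (simp add: J_def J_index_def)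
  next
    case (step k)
    then show ?case using reaches_threshold_Suc \<beta> \<theta> by blast
  qed
  then have after: "b (Suc k) = b k - w k" if "J \<le> k" for k
    using that bound_Suc_after[of \<beta> \<theta> k] \<beta> \<theta> by (simp add: b_def w_def)
  have b_ge: "\<beta> ^ k \<le> b k" for k
    unfolding b_def by (rule power_le_bound)
  have b_pos: "0 < b k" for k
    using b_ge[of k] \<beta> by (meson less_le_trans zero_less_power)
  have \<theta>b: "\<theta> * b k < b k" for k
    using b_pos[of k] \<theta> by simp

  \<comment> \<open>position of coordinate \<open>i\<close> at time \<open>j \<le> i\<close>\<close>
  define z where "z i j = b i - \<beta> ^ j + \<beta> ^ i" for i j
  have z_diag: "z i i = b i" for i by (simp add: z_def)
  have z_Suc: "z i (Suc j) = z i j + w j" for i j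
    by (simp add: z_def w_def algebra_simps)
  have z_le: "z i j \<le> b j" if "j \<le> i" "i \<le> J" for i j
    using that(1)
  proof (induction rule: inc_induct)
    case (step j)
    with before[of j] z_Suc[of i j] \<theta>b[of j] that(2) show ?case by simp
  qed (simp add: z_diag)
  have z_le_\<theta>: "z i j \<le> \<theta> * b j" if "j < i" "i \<le> J" for i j
    using z_le[of "Suc j" i] before[of j] z_Suc[of i j] that by simp
  \<comment> \<open>strict except in the last step before the turn of coordinate \<open>i\<close>: all but these ties have a margin\<close>
  have z_less_\<theta>: "z i j < \<theta> * b j" if "Suc j < i" "i \<le> J" for i j
    using z_le_\<theta>[of "Suc j" i] \<theta>b[of "Suc j"] before[of j] z_Suc[of i j] that by simp

  \<comment> \<open>margins of all required strict inequalities between values of \<open>h\<close>\<close>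
  define gaps where "gaps =
    (\<lambda>j. hyp (\<theta> * b j) - hyp (\<theta> * (\<theta> * b j))) ` {..<J} \<union>
    (\<lambda>(i, j). hyp (\<theta> * b j) - hyp (z i j)) ` {(i, j) \<in> {..J} \<times> {..J}. Suc j < i \<and> 0 < z i j}"
  have "finite {(i, j) \<in> {..J} \<times> {..J}. Suc j < i \<and> 0 < z i j}"
    by (rule finite_subset[of _ "{..J} \<times> {..J}"]) auto
  then have finite_gaps: "finite gaps" by (simp add: gaps_def)
  have gaps_pos: "0 < g" if "g \<in> gaps" for g
  proof -
    have "hyp (\<theta> * (\<theta> * b j)) < hyp (\<theta> * b j)" for j
    proof -
      have "\<theta> * (\<theta> * b j) < \<theta> * b j" using \<theta>b[of j] \<theta>(1) by simp
      moreover have "0 < \<theta> * (\<theta> * b j)" using b_pos[of j] \<theta>(1) by simp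
      ultimately show ?thesis by (simp add: hyp_less_iff)
    qed
    then have 1: "0 < hyp (\<theta> * b j) - hyp (\<theta> * (\<theta> * b j))" for j
      by (simp only: diff_gt_0_iff_gt)
    have 2: "0 < hyp (\<theta> * b j) - hyp (z i j)" if "Suc j < i" "i \<le> J" "0 < z i j" for i j
    proof -
      have "hyp (z i j) < hyp (\<theta> * b j)"
        using z_less_\<theta>[OF that(1,2)] that(3) by (simp add: hyp_less_iff)
      then show ?thesis by (simp only: diff_gt_0_iff_gt)
    qed
    from that consider j where "g = hyp (\<theta> * b j) - hyp (\<theta> * (\<theta> * b j))"
      | i j where "g = hyp (\<theta> * b j) - hyp (z i j)" "Suc j < i" "i \<le> J" "0 < z i j"
      unfolding gaps_def by fast
    then show ?thesis using 1 2 by cases metis+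
  qed
  obtain \<epsilon> where \<epsilon>: "0 < \<epsilon>" "\<And>g. g \<in> gaps \<Longrightarrow> \<epsilon> \<le> g"
    using finite_positive_lower_bound[OF finite_gaps gaps_pos] by auto
  define \<delta> where "\<delta> = \<epsilon> / (real J + 1)"
  have "0 < \<delta>" using \<epsilon>(1) by (simp add: \<delta>_def)
  have "(real J + 1) * \<delta> = \<epsilon>" unfolding \<delta>_def by simp
  then have J\<delta>: "real J * \<delta> + \<delta> = \<epsilon>" by (simp add: distrib_right)
  obtain \<psi> \<psi>' where "ramp \<delta> \<psi> \<psi>'" using ramp_exists[OF \<open>0 < \<delta>\<close>] by blast
  obtain \<iota> :: "nat \<Rightarrow> 'n" where "bij_betw \<iota> {..<J + 1} UNIV"
    using ex_bij_betw_nat_finite[of "UNIV :: 'n set"] card by (auto simp: J_def lessThan_atLeast0)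
  then interpret adversary \<delta> \<psi> \<psi>' \<theta> \<iota> "J + 1"
    using \<open>ramp \<delta> \<psi> \<psi>'\<close> \<theta>(1) by (simp add: adversary_def adversary_axioms_def)

  define \<tau> :: "'n tie_rule" where "\<tau> = (\<lambda>_ _ _. \<chi> i. -1)"
  have \<tau>: "tie_rule \<tau>" by (simp add: tie_rule_def \<tau>_def)
  define c0 :: "real^'n" where "c0 = (\<chi> m. z (the_inv_into {..<J + 1} \<iota> m) 0)"
  have c0: "c0 $ \<iota> i = z i 0" if "i \<le> J" for i
    using that \<iota>_bij by (simp add: c0_def bij_betw_def the_inv_into_f_f)
  have c0_bounds: "c0 $ m \<in> {-1..1}" for m
  proof -
    obtain i where i: "i < J + 1" "m = \<iota> i" by (rule \<iota>_cases)
    have "- 1 \<le> z i 0" using b_ge[of i] zero_less_power[OF \<beta>(1), of i] by (simp add: z_def)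
    moreover have "z i 0 \<le> 1" using z_le[of 0 i] i(1) by (simp add: b_def)
    ultimately show ?thesis using i c0[of i] by simp
  qed
  let ?c = "cube_sign \<beta> F \<tau> c0"
  have c_le: "infnorm (?c k) \<le> b k" for k
    unfolding b_def using \<beta> \<theta> c0_bounds F_in_M_class \<tau>
    by (intro infnorm_cube_sign_le) (auto simp: infnorm_le_iff abs_le_iff)

  have rising: "\<forall>i. j \<le> i \<and> i \<le> J \<longrightarrow> ?c j $ \<iota> i = z i j" for j
  proof (induction j)
    case 0
    then show ?case using c0 by (simp add: cube_sign_def)
  next
    case (Suc j)
    show ?case
    proof (intro allI impI, elim conjE)
      fix i assume i: "Suc j \<le> i" "i \<le> J"
      have x: "?c j $ \<iota> i = z i j" and xj: "?c j $ \<iota> j = b j"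
        using Suc i by (simp_all add: z_diag)
      obtain h where step: "?c (Suc j) = ?c j - w j *\<^sub>R chosen_signs F \<tau> h (?c j)"
        using cube_sign_Suc unfolding w_def by blast
      have "chosen_signs F \<tau> h (?c j) $ \<iota> i = -1"
      proof (cases "0 < z i j")
        case True
        have minorant: "hyp (\<theta> * b j) - real (i - Suc j) * \<delta> \<le> minorant i (?c j)"
          using minorant_ge[of j i "?c j"] i xj by simp
        have slack: "real (i - Suc j) * \<delta> \<le> real J * \<delta>"
          using i \<open>0 < \<delta>\<close> by (intro mult_right_mono) auto
        \<comment> \<open>coordinate \<open>i\<close> is invisible in its own summand\<close>
        have "hyp (z i j) \<le> minorant i (?c j)"
        proof (cases "i = Suc j")
          case True
          have "hyp (z i j) \<le> hyp (\<theta> * b j)"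
            using z_le_\<theta>[of j i] \<open>0 < z i j\<close> i by (simp add: hyp_le_iff)
          with minorant True show ?thesis by simp
        next
          case False
          then have "\<epsilon> \<le> hyp (\<theta> * b j) - hyp (z i j)"
            using i \<open>0 < z i j\<close> by (intro \<epsilon>(2)) (auto simp: gaps_def)
          with minorant slack J\<delta> \<open>0 < \<delta>\<close> show ?thesis by linarith
        qed
        \<comment> \<open>coordinate \<open>i\<close> is invisible in the later summands\<close>
        moreover have "\<delta> \<le> minorant i (?c j) - hyp (\<theta> * z i j)"
        proof -
          have "hyp (\<theta> * z i j) \<le> hyp (\<theta> * (\<theta> * b j))"
            using z_le_\<theta>[of j i] \<open>0 < z i j\<close> i \<theta> b_pos[of j]
            by (simp add: hyp_le_iff abs_mult abs_of_pos)
          moreover have "\<epsilon> \<le> hyp (\<theta> * b j) - hyp (\<theta> * (\<theta> * b j))"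
            using i by (intro \<epsilon>(2)) (auto simp: gaps_def)
          ultimately show ?thesis using minorant slack J\<delta> by linarith
        qed
        ultimately have "partial_deriv F (\<iota> i) (?c j) = 0"
          using i x by (intro partial_deriv_F_eq_0) simp_all
        then show ?thesis by (simp add: chosen_signs_def \<tau>_def)
      next
        case False
        \<comment> \<open>a nonpositive coordinate moves up by its own sign, or by the tie rule\<close>
        obtain q where "0 \<le> q" "partial_deriv F (\<iota> i) (?c j) = q * z i j"
          using partial_deriv_F_sign[of "\<iota> i" "?c j"] x by auto
        with False have "partial_deriv F (\<iota> i) (?c j) \<le> 0"
          by (simp add: mult_nonneg_nonpos)
        then show ?thesis by (simp add: chosen_signs_def \<tau>_def sgn_if)
      qed
      with step x show "?c (Suc j) $ \<iota> i = z i (Suc j)" by (simp add: z_Suc)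
    qed
  qed
  have last: "?c k $ \<iota> J = b k" if "J \<le> k" for k
    using that
  proof (induction rule: dec_induct)
    case base
    show ?case using rising[of J] by (simp add: z_diag)
  next
    case (step k)
    obtain h where Suc: "?c (Suc k) = ?c k - w k *\<^sub>R chosen_signs F \<tau> h (?c k)"
      using cube_sign_Suc unfolding w_def by blast
    have "\<theta> * infnorm (?c k) < \<bar>?c k $ \<iota> J\<bar>"
    proof -
      have "\<theta> * infnorm (?c k) \<le> \<theta> * b k" using c_le \<theta>(1) by (intro mult_left_mono) auto
      also have "\<dots> < b k" by (rule \<theta>b)
      finally show ?thesis using step.IH b_pos[of k] by simp
    qed
    from chosen_signs_M_class[OF F_in_M_class this, of \<tau> h] step Suc b_pos[of k] show ?case
      by (simp add: after)
  qed
  have "infnorm (?c k) = b k" for k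
  proof (rule antisym[OF c_le])
    obtain m where "?c k $ m = b k"
      using rising[of k] last[of k] z_diag[of k] by (metis le_cases order_refl)
    then show "b k \<le> infnorm (?c k)"
      using component_le_infnorm_cart[of "?c k" m] by simp
  qed
  moreover have "\<exists>L. L-lipschitz_on UNIV (grad F)"
    using F_has_lipschitz_gradient has_lipschitz_gradient_imp_grad[OF F_has_lipschitz_gradient]
    by (simp add: has_lipschitz_gradient_def)
  ultimately show ?thesis
    using convex_F smooth_F F_minimum F_in_M_class c0_bounds \<tau> unfolding b_def by blast
qed

text \<open>Here \<open>\<theta> + (1 - \<beta>) \<le> \<beta>\<close>, so \<open>\<beta>\<^sup>k\<close> solves the recursion; for \<open>F x = x\<^sup>2\<close> and \<open>c\<^sub>0 = 1\<close> the centre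
  \<open>c\<^sub>k = \<beta>\<^sup>k\<close> never reaches the minimiser and no tie occurs.\<close>

lemma quadratic_instance:
  fixes \<beta> \<theta> :: real
  assumes \<beta>: "1 / 2 \<le> \<beta>" "\<beta> < 1" and \<theta>: "0 \<le> \<theta>" "\<theta> \<le> 2 * \<beta> - 1"
  shows "\<exists>(F :: real^1 \<Rightarrow> real) (c0 :: real^1).
    (\<exists>p q r. p \<noteq> 0 \<and> F = (\<lambda>x. p * (x $ 1)^2 + q * (x $ 1) + r)) \<and>
    (\<forall>x. x \<noteq> 0 \<longrightarrow> F 0 < F x) \<and> c0 $ 1 \<in> {-1..1} \<and> F \<in> M_class \<theta> \<and>
    (\<forall>\<tau>. tie_rule \<tau> \<longrightarrow>
      (\<forall>k. \<bar>cube_sign \<beta> F \<tau> c0 k $ 1\<bar> = bound \<beta> \<theta> k \<and> bound \<beta> \<theta> k = \<beta> ^ k))"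
proof -
  define F :: "real^1 \<Rightarrow> real" where "F x = (x $ 1)\<^sup>2" for x
  have deriv: "(F has_derivative (\<lambda>v. 2 * x $ 1 * v $ 1)) (at x)" for x
    unfolding F_def
    by (auto intro!: derivative_eq_intros bounded_linear_imp_has_derivative bounded_linear_vec_nth)
  have partial: "partial_deriv F i x = 2 * x $ 1" for i x
    unfolding partial_deriv_def frechet_derivative_at[OF deriv[of x], symmetric]
    by (simp add: axis_def num1_eq1[of i])
  have F_M: "F \<in> M_class \<theta>"
    unfolding M_class_def
  proof (intro CollectI conjI allI impI)
    show "F differentiable (at x)" for x using deriv differentiable_def by blast
    fix x :: "real^1" and i :: 1
    assume "\<theta> * infnorm x < \<bar>x $ i\<bar>"
    moreover have "0 \<le> \<theta> * infnorm x" using \<theta> infnorm_pos_le[of x] by simp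
    ultimately have "x $ 1 \<noteq> 0" by (metis abs_zero leD num1_eq1)
    then show "0 < partial_deriv F i x * x $ i"
      by (simp add: partial num1_eq1[of i] flip: power2_eq_square)
  qed
  have b: "bound \<beta> \<theta> k = \<beta> ^ k" for k
  proof (induction k)
    case (Suc k)
    have "(\<theta> + (1 - \<beta>)) * \<beta> ^ k \<le> \<beta> * \<beta> ^ k"
      using \<beta> \<theta> by (intro mult_right_mono) auto
    with Suc show ?case by (simp add: algebra_simps max_def)
  qed simp
  define c0 :: "real^1" where "c0 = (\<chi> i. 1)"
  have c: "cube_sign \<beta> F \<tau> c0 k $ 1 = \<beta> ^ k" for \<tau> k
  proof (induction k)
    case 0
    then show ?case by (simp add: cube_sign_def c0_def)
  next
    case (Suc k)
    obtain h where "cube_sign \<beta> F \<tau> c0 (Suc k) = cube_sign \<beta> F \<tau> c0 k -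
        ((1 - \<beta>) * \<beta> ^ k) *\<^sub>R chosen_signs F \<tau> h (cube_sign \<beta> F \<tau> c0 k)"
      using cube_sign_Suc by blast
    moreover have "chosen_signs F \<tau> h (cube_sign \<beta> F \<tau> c0 k) $ 1 = 1"
      using \<beta> by (simp add: chosen_signs_def partial Suc)
    ultimately show ?case using Suc by (simp add: left_diff_distrib)
  qed
  show ?thesis
  proof (intro exI conjI allI impI)
    show "(1::real) \<noteq> 0" by simp
    show "F = (\<lambda>x. 1 * (x $ 1)\<^sup>2 + 0 * (x $ 1) + 0)" by (simp add: F_def[abs_def])
    show "F 0 < F x" if "x \<noteq> 0" for x
      using that by (auto simp: F_def vec_eq_iff forall_1)
    show "c0 $ 1 \<in> {-1..1}" by (simp add: c0_def)
    show "\<bar>cube_sign \<beta> F \<tau> c0 k $ 1\<bar> = bound \<beta> \<theta> k" for \<tau> k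
      using \<beta> by (simp add: c b)
  qed (use F_M b in auto)
qed

theorem theorem3p5:
  fixes \<beta> \<theta> :: real
  assumes "1/2 \<le> \<beta>" and "\<beta> < 1"
  shows
    "(0 < \<theta> \<and> \<theta> < 1 \<and> \<theta> > 2 * \<beta> - 1 \<longrightarrow>
        (\<exists>k. reaches_threshold \<beta> \<theta> k) \<and>
        (CARD('n::finite) = J_index \<beta> \<theta> + 1 \<longrightarrow>
          (\<exists>(F :: real^'n \<Rightarrow> real) (c0 :: real^'n).
             convex_on UNIV F \<and> smooth F \<and>
             (\<exists>L. L-lipschitz_on UNIV (grad F)) \<and>
             (\<forall>x. x \<noteq> 0 \<longrightarrow> F 0 < F x) \<and>
             (\<forall>i. c0 $ i \<in> {-1..1}) \<and>
             F \<in> M_class \<theta> \<and>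
             (\<exists>\<tau>. tie_rule \<tau> \<and>
                (\<forall>k. infnorm (cube_sign \<beta> F \<tau> c0 k) = bound \<beta> \<theta> k)))))
     \<and>
     (0 \<le> \<theta> \<and> \<theta> \<le> 2 * \<beta> - 1 \<longrightarrow>
        (\<exists>(F :: real^1 \<Rightarrow> real) (c0 :: real^1).
           (\<exists>p q r. p \<noteq> 0 \<and> F = (\<lambda>x. p * (x $ 1)^2 + q * (x $ 1) + r)) \<and>
           (\<forall>x. x \<noteq> 0 \<longrightarrow> F 0 < F x) \<and>
           c0 $ 1 \<in> {-1..1} \<and>
           F \<in> M_class \<theta> \<and>
           (\<forall>\<tau>. tie_rule \<tau> \<longrightarrow>
              (\<forall>k. \<bar>cube_sign \<beta> F \<tau> c0 k $ 1\<bar> = bound \<beta> \<theta> k \<and> bound \<beta> \<theta> k = \<beta> ^ k))))"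
proof (intro conjI impI)
  assume "0 < \<theta> \<and> \<theta> < 1 \<and> \<theta> > 2 * \<beta> - 1"
  then show "\<exists>k. reaches_threshold \<beta> \<theta> k"
    using assms by (intro reaches_threshold_exists) auto
next
  assume "0 < \<theta> \<and> \<theta> < 1 \<and> \<theta> > 2 * \<beta> - 1" and card: "CARD('n) = J_index \<beta> \<theta> + 1"
  then have "0 < \<beta>" "0 < \<theta>" "\<theta> < 1" "2 * \<beta> - 1 < \<theta>" using assms by auto
  from adversarial_instance[OF this(1) assms(2) this(2-4) card]
  show "\<exists>(F :: real^'n \<Rightarrow> real) (c0 :: real^'n).
             convex_on UNIV F \<and> smooth F \<and>
             (\<exists>L. L-lipschitz_on UNIV (grad F)) \<and>
             (\<forall>x. x \<noteq> 0 \<longrightarrow> F 0 < F x) \<and>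
             (\<forall>i. c0 $ i \<in> {-1..1}) \<and>
             F \<in> M_class \<theta> \<and>
             (\<exists>\<tau>. tie_rule \<tau> \<and>
                (\<forall>k. infnorm (cube_sign \<beta> F \<tau> c0 k) = bound \<beta> \<theta> k))" .
next
  assume "0 \<le> \<theta> \<and> \<theta> \<le> 2 * \<beta> - 1"
  then show "\<exists>(F :: real^1 \<Rightarrow> real) (c0 :: real^1).
           (\<exists>p q r. p \<noteq> 0 \<and> F = (\<lambda>x. p * (x $ 1)^2 + q * (x $ 1) + r)) \<and>
           (\<forall>x. x \<noteq> 0 \<longrightarrow> F 0 < F x) \<and>
           c0 $ 1 \<in> {-1..1} \<and>
           F \<in> M_class \<theta> \<and>
           (\<forall>\<tau>. tie_rule \<tau> \<longrightarrow>
              (\<forall>k. \<bar>cube_sign \<beta> F \<tau> c0 k $ 1\<bar> = bound \<beta> \<theta> k \<and> bound \<beta> \<theta> k = \<beta> ^ k))"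
    using assms by (intro quadratic_instance) auto
qed

end
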